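(* Let $d\ge3$ and let $T^d$ be the infinite $d$-regular tree. For every exhaustion $V_1\subset V_2\subset\cdots$ of the vertex set of $T^d$, $\nu_{G_n}\Rightarrow\nu$ for a unique probability measure $\nu$ on $\{0,1,\dots,d-1\}^{V(T^d)}$ that does not depend on the exhaustion.
   Context: An exhaustion is a sequence of finite vertex sets $V_1\subset V_2\subset\cdots$ with union the whole vertex set. $G_n$ is the wired graph obtained from $T^d$ by identifying all vertices outside $V_n$ to a single sink $s$ and removing loops at $s$. $\nu_{G_n}$ is the stationary distribution of the Abelian sandpile Markov chain on $G_n$ with sink $s$ (uniform on recurrent configurations; a vertex $x$ with at least $\deg(x)=d$ particles topples by sending one particle to each neighbour, particles sent to $s$ being lost; the chain adds a particle at a random vertex of $V_n$ and stabilizes). Weak convergence $\Rightarrow$ means convergence of the joint law of $(\eta_x)_{x\in A}$ for every finite vertex set $A$. *)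

theory Defs
  imports "HOL-Probability.Probability"
begin

text \<open>The infinite d-regular tree T^d: vertices are words (a_1,...,a_k) with
  a_1 < d and a_i < d - 1 for i \<ge> 2; the empty word is the root.  Two vertices
  are adjacent iff one is obtained from the other by appending one letter.
  The root has d children, every other vertex has one parent and d-1 children.\<close>

definition tree_verts :: "nat \<Rightarrow> nat list set" where
  "tree_verts d = {xs. \<forall>i<length xs. xs ! i < (if i = 0 then d else d - 1)}"

definition tree_adj :: "nat list \<Rightarrow> nat list \<Rightarrow> bool" where
  "tree_adj x y \<longleftrightarrow> (\<exists>a. y = x @ [a]) \<or> (\<exists>a. x = y @ [a])"

text \<open>Sandpile configurations on the wired graph G with vertex set V (finite subset of
  tree vertices) plus the sink: functions on tree vertices, zero outside V.
  Every vertex of V has degree d in G (edges to vertices outside V become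
  edges to the sink).\<close>

definition stable_configs :: "nat \<Rightarrow> nat list set \<Rightarrow> (nat list \<Rightarrow> nat) set" where
  "stable_configs d V = {\<eta>. (\<forall>y\<in>V. \<eta> y < d) \<and> (\<forall>y. y \<notin> V \<longrightarrow> \<eta> y = 0)}"

definition topple :: "nat \<Rightarrow> nat list set \<Rightarrow> (nat list \<Rightarrow> nat) \<Rightarrow> (nat list \<Rightarrow> nat) \<Rightarrow> bool" where
  "topple d V \<eta> \<zeta> \<longleftrightarrow> (\<exists>x\<in>V. d \<le> \<eta> x \<and>
     \<zeta> = (\<lambda>y. if y = x then \<eta> x - d else if y \<in> V \<and> tree_adj x y then \<eta> y + 1 else \<eta> y))"

text \<open>One step of the Abelian sandpile Markov chain (transitions of positive probability):
  add a particle at some vertex x of V and stabilize.\<close>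

definition chain_step :: "nat \<Rightarrow> nat list set \<Rightarrow> (nat list \<Rightarrow> nat) \<Rightarrow> (nat list \<Rightarrow> nat) \<Rightarrow> bool" where
  "chain_step d V \<eta> \<zeta> \<longleftrightarrow>
     (\<exists>x\<in>V. (topple d V)\<^sup>*\<^sup>* (\<eta>(x := \<eta> x + 1)) \<zeta> \<and> \<zeta> \<in> stable_configs d V)"

definition recurrent_configs :: "nat \<Rightarrow> nat list set \<Rightarrow> (nat list \<Rightarrow> nat) set" where
  "recurrent_configs d V = {\<eta> \<in> stable_configs d V.
     \<forall>\<zeta>. (chain_step d V)\<^sup>*\<^sup>* \<eta> \<zeta> \<longrightarrow> (chain_step d V)\<^sup>*\<^sup>* \<zeta> \<eta>}"

definition sandpile_marginal ::
    "nat \<Rightarrow> nat list set \<Rightarrow> nat list set \<Rightarrow> (nat list \<Rightarrow> nat) \<Rightarrow> real" where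
  "sandpile_marginal d V A p =
     real (card {\<eta> \<in> recurrent_configs d V. \<forall>x\<in>A. \<eta> x = p x})
       / real (card (recurrent_configs d V))"

definition exhaustion :: "nat \<Rightarrow> (nat \<Rightarrow> nat list set) \<Rightarrow> bool" where
  "exhaustion d V \<longleftrightarrow> (\<forall>n. finite (V n) \<and> V n \<subseteq> tree_verts d \<and> V n \<subseteq> V (Suc n))
     \<and> (\<Union>n. V n) = tree_verts d"

definition config_space :: "nat \<Rightarrow> (nat list \<Rightarrow> nat) measure" where
  "config_space d = PiM (tree_verts d) (\<lambda>_. count_space {..<d})"

text \<open>Weak convergence \<nu>_{G_n} \<Rightarrow> \<nu>: convergence of all finite-dimensional laws.\<close>

definition sandpile_converges ::
    "nat \<Rightarrow> (nat \<Rightarrow> nat list set) \<Rightarrow> (nat list \<Rightarrow> nat) measure \<Rightarrow> bool" where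
  "sandpile_converges d V \<nu> \<longleftrightarrow>
     (\<forall>A p. finite A \<longrightarrow> A \<subseteq> tree_verts d \<longrightarrow>
        (\<lambda>n. sandpile_marginal d (V n) A p)
          \<longlonglongrightarrow> measure \<nu> {\<omega> \<in> space \<nu>. \<forall>x\<in>A. \<omega> x = p x})"

end

theory Submission
  imports Defs
begin

text \<open>
  By Dhar's burning algorithm a stable configuration on the wired graph of V is recurrent iff it
  has no forbidden subconfiguration, i.e. every nonempty F in V has a vertex holding at least as
  many particles as it has neighbours in F.  Remove the vertices of V outside a ball B one leaf
  at a time.  A leaf either burns before its parent or only after it ("weak"), and the weak
  leaves act on their parents as independent marks: if r(v) denotes the probability that v is
  weak, then r(v) = 1 / (d - sum of r(c) over the children c of v), with r = 0 outside V.  Hence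
  the marginal on B is a rational function, not depending on V, of the values of r on the
  children of B outside B.  The recursion contracts by the factor 1 / (d - 1) around its fixed
  point 1 / (d - 1), so these values converge along every exhaustion to the same limit.
  Kolmogorov's extension theorem then provides the limit measure.
\<close>

subsection \<open>Recurrent configurations and the burning algorithm\<close>

text \<open>The law of the marks stays a product law when a leaf v is removed, for a counting
  reason. Let k of the children of v be weak. Of the d values at v, those below k are forbidden, the
  value k makes v weak, and the d - 1 - k larger ones let v burn before its parent. The number k
  enters linearly, and what remains without v does not see the children of v, so averaging over
  their marks replaces k by the sum s of their probabilities. The weights d - 1 - s and 1 have total
  d - s; divided by it they are the probabilities 1 - r(v) and r(v) of an independent mark at v. The
  factors d - s depend on V but not on the configuration on B, so they cancel on normalization. V
  may be disconnected: a child outside V belongs to the sink, which burns at the start, hence r = 0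
  there.

  In the recurrence criterion the harder direction is that a configuration without forbidden
  subconfigurations is recurrent. Adding one particle per sink edge and stabilizing returns it; from
  this, additions with the same effect are built that use any prescribed vertex, and so every step
  of the chain can be undone.\<close>

definition child :: "nat list \<Rightarrow> nat list \<Rightarrow> bool" where
  "child x y \<longleftrightarrow> (\<exists>a. y = x @ [a])"

lemma tree_adj_child: "tree_adj x y \<longleftrightarrow> child x y \<or> child y x"
  by (auto simp: tree_adj_def child_def)

lemma tree_adj_sym: "tree_adj x y \<longleftrightarrow> tree_adj y x"
  by (auto simp: tree_adj_def)

lemma tree_adj_irrefl [simp]: "\<not> tree_adj x x"
  by (auto simp: tree_adj_def)

lemma Nil_in_tree_verts [simp]: "[] \<in> tree_verts d"
  by (simp add: tree_verts_def)

lemma snoc_in_tree_verts: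
  "xs @ [a] \<in> tree_verts d \<longleftrightarrow> xs \<in> tree_verts d \<and> a < (if xs = [] then d else d - 1)"
  by (cases xs) (auto simp: tree_verts_def nth_append All_less_Suc)

lemma neighbours_tree_verts:
  assumes "x \<in> tree_verts d"
  shows "finite {y \<in> tree_verts d. tree_adj x y} \<and> card {y \<in> tree_verts d. tree_adj x y} \<le> d"
proof -
  have "\<exists>S. finite S \<and> card S \<le> d \<and> {y \<in> tree_verts d. tree_adj x y} \<subseteq> S"
  proof (cases x rule: rev_cases)
    case Nil
    have "{y \<in> tree_verts d. tree_adj x y} \<subseteq> (\<lambda>a. x @ [a]) ` {..<d}"
    proof safe
      fix y assume y: "y \<in> tree_verts d" "tree_adj x y"
      then obtain a where "y = x @ [a]" using Nil by (auto simp: tree_adj_def)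
      with y(1) show "y \<in> (\<lambda>a. x @ [a]) ` {..<d}"
        using Nil snoc_in_tree_verts[of x a d] by auto
    qed
    moreover have "card ((\<lambda>a. x @ [a]) ` {..<d}) \<le> d"
      using card_image_le[of "{..<d}" "\<lambda>a. x @ [a]"] by simp
    ultimately show ?thesis by blast
  next
    case (snoc u a)
    define S where "S = insert u ((\<lambda>a. x @ [a]) ` {..<d - 1})"
    have "{y \<in> tree_verts d. tree_adj x y} \<subseteq> S"
    proof safe
      fix y assume y: "y \<in> tree_verts d" "tree_adj x y"
      then consider "y = u" | b where "y = x @ [b]" using snoc by (auto simp: tree_adj_def)
      then show "y \<in> S"
      proof cases
        case 2
        then show ?thesis using y(1) snoc snoc_in_tree_verts[of x b d] by (auto simp: S_def)
      qed (simp add: S_def)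
    qed
    \<comment> \<open>The last letter of x witnesses d > 0. For d = 0 truncated subtraction would
      leave no children, but the parent alone would exceed the bound.\<close>
    moreover have "a < d" using assms snoc snoc_in_tree_verts[of u a d] by (auto split: if_splits)
    then have "card S \<le> d"
      using card_insert_le_m1[of d "(\<lambda>a. x @ [a]) ` {..<d - 1}" u]
        card_image_le[of "{..<d - 1}" "\<lambda>a. x @ [a]"] by (simp add: S_def)
    ultimately show ?thesis by (intro exI[of _ S]) (auto simp: S_def)
  qed
  then show ?thesis by (meson card_mono finite_subset le_trans)
qed

lemma degree_le:
  assumes "V \<subseteq> tree_verts d" "x \<in> tree_verts d"
  shows "card {y \<in> V. tree_adj x y} \<le> d"
proof -
  have "{y \<in> V. tree_adj x y} \<subseteq> {y \<in> tree_verts d. tree_adj x y}" using assms(1) by blast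
  with neighbours_tree_verts[OF assms(2)] show ?thesis by (meson card_mono le_trans)
qed

text \<open>Vertices of J outside W are children of W that burn only after their parent has burnt;
  J = {} gives the absence of forbidden subconfigurations.\<close>

definition allowed ::
    "nat list set \<Rightarrow> nat list set \<Rightarrow> (nat list \<Rightarrow> nat) \<Rightarrow> bool" where
  "allowed W J \<eta> \<longleftrightarrow> (\<forall>F\<subseteq>W. F \<noteq> {} \<longrightarrow>
     (\<exists>x\<in>F. card {y \<in> F. tree_adj x y} + card {y \<in> J - W. child x y} \<le> \<eta> x))"

lemma allowed_mono:
  assumes "allowed W J \<eta>" "\<And>x. x \<in> W \<Longrightarrow> \<eta> x \<le> \<zeta> x"
  shows "allowed W J \<zeta>"
  unfolding allowed_def
proof (intro allI impI)
  fix F assume F: "F \<subseteq> W" "F \<noteq> {}"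
  then obtain x where "x \<in> F" "card {y \<in> F. tree_adj x y} + card {y \<in> J - W. child x y} \<le> \<eta> x"
    using assms(1) unfolding allowed_def by meson
  then show "\<exists>x\<in>F. card {y \<in> F. tree_adj x y} + card {y \<in> J - W. child x y} \<le> \<zeta> x"
    using assms(2) F by (meson order_trans subsetD)
qed

text \<open>Toppling at x turns a forbidden set F of the new configuration into the
  forbidden set F - {x} of the old one.\<close>

lemma topple_allowed:
  assumes "topple d V \<eta> \<zeta>" "allowed V {} \<eta>" "finite V"
  shows "allowed V {} \<zeta>"
proof -
  from assms(1) obtain x where x: "x \<in> V" "d \<le> \<eta> x"
    and z: "\<zeta> = (\<lambda>y. if y = x then \<eta> x - d else if y \<in> V \<and> tree_adj x y then \<eta> y + 1 else \<eta> y)"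
    unfolding topple_def by blast
  have "\<exists>y\<in>F. card {w \<in> F. tree_adj y w} \<le> \<zeta> y" if F: "F \<subseteq> V" "F \<noteq> {}" for F
  \<comment> \<open>Removing x from {x} would leave the empty set, about which
    \<open>allowed\<close> says nothing; there x has no neighbour in F.\<close>
  proof (cases "F = {x}")
    case True
    then have "{w \<in> F. tree_adj x w} = {}" by auto
    then show ?thesis using True by (metis card.empty singletonI zero_le)
  next
    case False
    then have "F - {x} \<subseteq> V" "F - {x} \<noteq> {}" using F by auto
    then obtain y where "y \<in> F - {x}"
      "card {w \<in> F - {x}. tree_adj y w} + card {w \<in> {} - V. child y w} \<le> \<eta> y"
      using assms(2) unfolding allowed_def by meson
    then have y: "y \<in> F - {x}" "card {w \<in> F - {x}. tree_adj y w} \<le> \<eta> y" by auto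
    have fin: "finite F" using F assms(3) finite_subset by blast
    \<comment> \<open>Putting x back gives y at most one more neighbour, and exactly in that case y
      has received a particle from x.\<close>
    have "card {w \<in> F. tree_adj y w} \<le> card {w \<in> F - {x}. tree_adj y w} + (if tree_adj x y then 1 else 0)"
    proof (cases "tree_adj x y")
      case True
      have "{w \<in> F. tree_adj y w} \<subseteq> insert x {w \<in> F - {x}. tree_adj y w}" by auto
      then have "card {w \<in> F. tree_adj y w} \<le> card (insert x {w \<in> F - {x}. tree_adj y w})"
        using fin by (intro card_mono) auto
      then show ?thesis using True fin by (auto simp: card_insert_if)
    next
      case False
      then have "{w \<in> F. tree_adj y w} = {w \<in> F - {x}. tree_adj y w}"
        using tree_adj_sym by blast
      then show ?thesis by simp
    qed
    also have "\<dots> \<le> \<zeta> y" using y F by (auto simp: z)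
    finally show ?thesis using y by blast
  qed
  then show ?thesis by (auto simp: allowed_def)
qed

lemma topple_rtranclp_allowed:
  assumes "(topple d V)\<^sup>*\<^sup>* \<eta> \<zeta>" "allowed V {} \<eta>" "finite V"
  shows "allowed V {} \<zeta>"
  using assms by (induction rule: rtranclp_induct) (auto intro: topple_allowed)

lemma chain_step_allowed:
  assumes "chain_step d V \<eta> \<zeta>" "allowed V {} \<eta>" "finite V"
  shows "allowed V {} \<zeta>"
proof -
  obtain x where "(topple d V)\<^sup>*\<^sup>* (\<eta>(x := \<eta> x + 1)) \<zeta>"
    using assms(1) unfolding chain_step_def by blast
  moreover have "allowed V {} (\<eta>(x := \<eta> x + 1))"
    by (rule allowed_mono[OF assms(2)]) auto
  ultimately show ?thesis using topple_rtranclp_allowed assms(3) by blast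
qed

definition max_config :: "nat \<Rightarrow> nat list set \<Rightarrow> nat list \<Rightarrow> nat" where
  "max_config d V = (\<lambda>y. if y \<in> V then d - 1 else 0)"

text \<open>A longest vertex of a finite set F has at most its parent as a neighbour in F.\<close>

lemma allowed_max_config:
  assumes "finite V" "d \<ge> 2"
  shows "allowed V {} (max_config d V)"
proof -
  have "\<exists>x\<in>F. card {y \<in> F. tree_adj x y} \<le> max_config d V x" if F: "F \<subseteq> V" "F \<noteq> {}" for F
  proof -
    have fin: "finite F" using F assms finite_subset by blast
    have "Max (length ` F) \<in> length ` F" using fin F(2) by (intro Max_in) auto
    then obtain x where "x \<in> F" "length x = Max (length ` F)" by auto
    with fin have x: "x \<in> F" "\<And>y. y \<in> F \<Longrightarrow> length y \<le> length x" by auto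
    have "{y \<in> F. tree_adj x y} \<subseteq> {butlast x}"
      using x(2) by (fastforce simp: tree_adj_def)
    then have "card {y \<in> F. tree_adj x y} \<le> 1"
      using card_mono[of "{butlast x}" "{y \<in> F. tree_adj x y}"] by simp
    then show ?thesis using x(1) F assms(2) by (intro bexI[of _ x]) (auto simp: max_config_def)
  qed
  then show ?thesis by (auto simp: allowed_def)
qed

text \<open>Filling a vertex that holds fewer than d - 1 particles triggers no toppling, so the
  total number of missing particles can be brought to 0 by additions alone.\<close>

lemma chain_to_max_config:
  assumes "\<eta> \<in> stable_configs d V" "finite V" "d \<ge> 2"
  shows "(chain_step d V)\<^sup>*\<^sup>* \<eta> (max_config d V)"
  using assms
proof (induction "\<Sum>x\<in>V. d - 1 - \<eta> x" arbitrary: \<eta> rule: less_induct)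
  case less
  show ?case
  proof (cases "\<exists>x\<in>V. \<eta> x < d - 1")
    case True
    then obtain x where x: "x \<in> V" "\<eta> x < d - 1" by blast
    let ?z = "\<eta>(x := \<eta> x + 1)"
    have st: "?z \<in> stable_configs d V"
      using x less.prems by (auto simp: stable_configs_def)
    have "chain_step d V \<eta> ?z"
      using x st unfolding chain_step_def by blast
    moreover have "(\<Sum>y\<in>V. d - 1 - ?z y) < (\<Sum>y\<in>V. d - 1 - \<eta> y)"
      using x less.prems(2) by (intro sum_strict_mono_ex1) auto
    ultimately show ?thesis using less.hyps[of ?z] st less.prems
      by (meson converse_rtranclp_into_rtranclp)
  next
    case False
    then have "\<eta> = max_config d V"
      using less.prems(1) by (fastforce simp: max_config_def stable_configs_def)
    then show ?thesis by simp
  qed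
qed

text \<open>Every stable configuration leads to \<open>max_config\<close>, so a recurrent one is
  also reached from it; \<open>allowed\<close> holds there and is preserved along the chain.\<close>

lemma recurrent_imp_allowed:
  assumes "\<eta> \<in> recurrent_configs d V" "finite V" "d \<ge> 2"
  shows "allowed V {} \<eta>"
proof -
  have "(chain_step d V)\<^sup>*\<^sup>* (max_config d V) \<eta>"
    using assms chain_to_max_config unfolding recurrent_configs_def by blast
  then show ?thesis
    by (induction rule: rtranclp_induct)
       (use assms allowed_max_config chain_step_allowed in auto)
qed

section \<open>The Abelian property of toppling\<close>

definition add_config :: "(nat list \<Rightarrow> nat) \<Rightarrow> (nat list \<Rightarrow> nat) \<Rightarrow> nat list \<Rightarrow> nat" where
  "add_config \<eta> \<gamma> = (\<lambda>y. \<eta> y + \<gamma> y)"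

lemma topple_add_config:
  assumes "topple d V \<eta> \<zeta>"
  shows "topple d V (add_config \<eta> \<gamma>) (add_config \<zeta> \<gamma>)"
proof -
  obtain x where x: "x \<in> V" "d \<le> \<eta> x"
    "\<zeta> = (\<lambda>y. if y = x then \<eta> x - d else if y \<in> V \<and> tree_adj x y then \<eta> y + 1 else \<eta> y)"
    using assms unfolding topple_def by blast
  then show ?thesis unfolding topple_def add_config_def by (intro bexI[of _ x]) (auto simp: fun_eq_iff)
qed

lemma topple_rtranclp_add_config:
  assumes "(topple d V)\<^sup>*\<^sup>* \<eta> \<zeta>"
  shows "(topple d V)\<^sup>*\<^sup>* (add_config \<eta> \<gamma>) (add_config \<zeta> \<gamma>)"
  using assms by (induction rule: rtranclp_induct) (auto intro: topple_add_config rtranclp.rtrancl_into_rtrancl)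

lemma topple_relpowp_add_config:
  assumes "(topple d V ^^ n) \<eta> \<zeta>"
  shows "(topple d V ^^ n) (add_config \<eta> \<gamma>) (add_config \<zeta> \<gamma>)"
  using assms by (induction n arbitrary: \<zeta>) (auto intro: topple_add_config)

text \<open>Toppling at x takes no particle from another vertex, so an unstable y stays unstable,
  and the two topplings commute.\<close>

lemma topple_diamond:
  assumes "topple d V \<eta> \<zeta>" "topple d V \<eta> \<xi>" "\<zeta> \<noteq> \<xi>"
  shows "\<exists>\<omega>. topple d V \<zeta> \<omega> \<and> topple d V \<xi> \<omega>"
proof -
  define T where "T x \<eta> = (\<lambda>y. if y = x then \<eta> x - d else if y \<in> V \<and> tree_adj x y then \<eta> y + 1 else \<eta> y)"
    for x and \<eta> :: "nat list \<Rightarrow> nat"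
  obtain x where x: "x \<in> V" "d \<le> \<eta> x" "\<zeta> = T x \<eta>"
    using assms(1) unfolding topple_def T_def by blast
  obtain y where y: "y \<in> V" "d \<le> \<eta> y" "\<xi> = T y \<eta>"
    using assms(2) unfolding topple_def T_def by blast
  have "x \<noteq> y" using assms(3) x y by blast
  then have "T y (T x \<eta>) = T x (T y \<eta>)" "d \<le> T x \<eta> y" "d \<le> T y \<eta> x"
    using x y tree_adj_sym[of x y] by (auto simp: T_def fun_eq_iff)
  moreover have "topple d V \<omega> (T z \<omega>)" if "z \<in> V" "d \<le> \<omega> z" for z \<omega>
    using that unfolding topple_def T_def by blast
  ultimately have "topple d V \<zeta> (T y (T x \<eta>))" "topple d V \<xi> (T x (T y \<eta>))"
    using x y \<open>x \<noteq> y\<close> unfolding x(3) y(3) by blast+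
  with \<open>T y (T x \<eta>) = T x (T y \<eta>)\<close> show ?thesis by metis
qed

text \<open>The normal forms of \<open>topple\<close>. Unlike \<open>stable_configs\<close> this
  asks for nothing outside V, which toppling leaves unchanged anyway.\<close>

definition terminal :: "nat \<Rightarrow> nat list set \<Rightarrow> (nat list \<Rightarrow> nat) \<Rightarrow> bool" where
  "terminal d V \<eta> \<longleftrightarrow> (\<forall>x\<in>V. \<eta> x < d)"

lemma terminal_iff: "terminal d V \<eta> \<longleftrightarrow> (\<nexists>\<zeta>. topple d V \<eta> \<zeta>)"
proof -
  have "(\<exists>\<zeta>. topple d V \<eta> \<zeta>) \<longleftrightarrow> (\<exists>x\<in>V. d \<le> \<eta> x)" unfolding topple_def by blast
  then show ?thesis by (auto simp: terminal_def not_less)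
qed

text \<open>Exchange argument: a different first toppling is joined with the given one by the
  diamond, and the induction hypothesis applies one step later. Lengths are recorded because they
  later bound the number of topplings.\<close>

lemma topple_strip:
  assumes "(topple d V ^^ n) \<eta> \<zeta>" "terminal d V \<zeta>" "topple d V \<eta> \<xi>"
  shows "\<exists>m. n = Suc m \<and> (topple d V ^^ m) \<xi> \<zeta>"
  using assms
proof (induction n arbitrary: \<eta> \<xi>)
  case 0
  then show ?case by (auto simp: terminal_iff)
next
  case (Suc n)
  then obtain \<eta>' where e: "topple d V \<eta> \<eta>'" "(topple d V ^^ n) \<eta>' \<zeta>"
    using relpowp_Suc_D2 by metis
  show ?case
  proof (cases "\<eta>' = \<xi>")
    case False
    then obtain \<omega> where w: "topple d V \<eta>' \<omega>" "topple d V \<xi> \<omega>"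
      using topple_diamond e(1) Suc.prems(3) by blast
    then obtain m where "n = Suc m" "(topple d V ^^ m) \<omega> \<zeta>"
      using Suc.IH e(2) Suc.prems(2) by blast
    then show ?thesis using w(2) relpowp_Suc_I2 by metis
  qed (use e in auto)
qed

lemma topple_strip_many:
  assumes "(topple d V ^^ n) \<eta> \<zeta>" "terminal d V \<zeta>" "(topple d V ^^ k) \<eta> \<xi>"
  shows "k \<le> n \<and> (topple d V ^^ (n - k)) \<xi> \<zeta>"
  using assms(3)
proof (induction k arbitrary: \<xi>)
  case 0
  then show ?case using assms by simp
next
  case (Suc k)
  then obtain \<omega> where "(topple d V ^^ k) \<eta> \<omega>" "topple d V \<omega> \<xi>" by auto
  then obtain m where "n - k = Suc m" "(topple d V ^^ m) \<xi> \<zeta>"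
    using Suc.IH[of \<omega>] topple_strip[of "n - k" d V \<omega> \<zeta> \<xi>] assms(2) by blast
  moreover from this have "m = n - Suc k" by simp
  ultimately show ?case by simp
qed

lemma topple_confluent:
  assumes "(topple d V)\<^sup>*\<^sup>* \<eta> \<zeta>" "terminal d V \<zeta>" "(topple d V)\<^sup>*\<^sup>* \<eta> \<xi>"
  shows "(topple d V)\<^sup>*\<^sup>* \<xi> \<zeta>"
  using assms topple_strip_many by (metis rtranclp_imp_relpowp relpowp_imp_rtranclp)

text \<open>Termination by comparison: every toppling sequence from \<eta> is also one from \<eta> +
  \<gamma>, hence has length at most n, and a longest one must end in a terminal
  configuration.\<close>

lemma stabilization_exists:
  assumes "(topple d V ^^ n) (add_config \<eta> \<gamma>) \<zeta>" "terminal d V \<zeta>"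
  shows "\<exists>\<xi>. (topple d V)\<^sup>*\<^sup>* \<eta> \<xi> \<and> terminal d V \<xi>"
proof -
  define P where "P k \<longleftrightarrow> (\<exists>\<xi>. (topple d V ^^ k) \<eta> \<xi>)" for k
  have "P 0" by (auto simp: P_def)
  moreover have "\<forall>k. P k \<longrightarrow> k \<le> n"
    using topple_relpowp_add_config topple_strip_many[OF assms] unfolding P_def by blast
  ultimately obtain k where k: "P k" "\<And>j. P j \<Longrightarrow> j \<le> k"
    using GreatestI_nat[of P 0 n] Greatest_le_nat[of P _ n] by blast
  then obtain \<xi> where "(topple d V ^^ k) \<eta> \<xi>" by (auto simp: P_def)
  moreover have "terminal d V \<xi>"
    using k(2)[of "Suc k"] calculation unfolding terminal_iff P_def by auto
  ultimately show ?thesis using relpowp_imp_rtranclp by metis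
qed

lemma topple_rtranclp_outside:
  assumes "(topple d V)\<^sup>*\<^sup>* \<eta> \<zeta>" "y \<notin> V"
  shows "\<zeta> y = \<eta> y"
  using assms(1)
proof (induction rule: rtranclp_induct)
  case base
  show ?case by (rule refl)
next
  case (step \<xi> \<omega>)
  then obtain x where "x \<in> V"
    "\<omega> = (\<lambda>y. if y = x then \<xi> x - d else if y \<in> V \<and> tree_adj x y then \<xi> y + 1 else \<xi> y)"
    unfolding topple_def by blast
  with step.IH assms(2) show ?case by auto
qed

text \<open>The particles of \<gamma> are added one at a time with stabilization in between. By
  confluence this does not change the final result, and each addition is one step of the
  chain.\<close>

lemma chain_of_add_config:
  assumes "(topple d V)\<^sup>*\<^sup>* (add_config \<zeta> \<gamma>) \<eta>" "\<zeta> \<in> stable_configs d V"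
    "\<eta> \<in> stable_configs d V" "finite V" "\<And>y. y \<notin> V \<Longrightarrow> \<gamma> y = 0"
  shows "(chain_step d V)\<^sup>*\<^sup>* \<zeta> \<eta>"
  using assms
proof (induction "\<Sum>x\<in>V. \<gamma> x" arbitrary: \<zeta> \<gamma>)
  case 0
  then have "\<gamma> x = 0" for x by (metis sum_eq_0_iff)
  then have *: "add_config \<zeta> \<gamma> = \<zeta>" by (simp add: add_config_def fun_eq_iff)
  have "terminal d V \<zeta>" using 0 by (auto simp: stable_configs_def terminal_def)
  then have "\<zeta> = \<eta>" using 0(2) unfolding *
    by (metis converse_rtranclpE terminal_iff)
  then show ?case by simp
next
  case (Suc n)
  have "(\<Sum>x\<in>V. \<gamma> x) \<noteq> 0" by (metis Suc.hyps(2) nat.distinct(2))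
  then obtain x where x: "x \<in> V" "\<gamma> x > 0" by (meson neq0_conv sum.neutral)
  define \<gamma>' where "\<gamma>' = \<gamma>(x := \<gamma> x - 1)"
  define \<zeta>' where "\<zeta>' = \<zeta>(x := \<zeta> x + 1)"
  have eq: "add_config \<zeta> \<gamma> = add_config \<zeta>' \<gamma>'"
    using x by (auto simp: add_config_def \<gamma>'_def \<zeta>'_def fun_eq_iff)
  have tm: "terminal d V \<eta>" using Suc.prems by (auto simp: stable_configs_def terminal_def)
  obtain k where "(topple d V ^^ k) (add_config \<zeta>' \<gamma>') \<eta>"
    using Suc.prems(1) eq rtranclp_imp_relpowp by metis
  \<comment> \<open>The stabilization after a single addition exists because the configuration with
    all remaining particles on top stabilizes.\<close>
  then obtain \<xi> where xi: "(topple d V)\<^sup>*\<^sup>* \<zeta>' \<xi>" "terminal d V \<xi>"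
    using stabilization_exists tm by blast
  have "\<forall>y. y \<notin> V \<longrightarrow> \<xi> y = 0"
    using topple_rtranclp_outside[OF xi(1)] Suc.prems(2) x by (auto simp: \<zeta>'_def stable_configs_def)
  then have st: "\<xi> \<in> stable_configs d V" using xi(2) by (auto simp: stable_configs_def terminal_def)
  have "chain_step d V \<zeta> \<xi>" using x xi st unfolding chain_step_def \<zeta>'_def by blast
  moreover have "(topple d V)\<^sup>*\<^sup>* (add_config \<xi> \<gamma>') \<eta>"
    using topple_confluent[OF _ tm topple_rtranclp_add_config[OF xi(1)]] Suc.prems(1) eq by metis
  moreover have "n = (\<Sum>x\<in>V. \<gamma>' x)"
  proof -
    have "(\<Sum>y\<in>V. \<gamma> y) = \<gamma> x + (\<Sum>y\<in>V - {x}. \<gamma> y)"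
      using x Suc.prems(4) by (simp add: sum.remove)
    moreover have "(\<Sum>y\<in>V. \<gamma>' y) = \<gamma>' x + (\<Sum>y\<in>V - {x}. \<gamma>' y)"
      using x Suc.prems(4) by (simp add: sum.remove)
    moreover have "(\<Sum>y\<in>V - {x}. \<gamma>' y) = (\<Sum>y\<in>V - {x}. \<gamma> y)"
      by (intro sum.cong) (auto simp: \<gamma>'_def)
    ultimately show ?thesis using Suc.hyps(2) x by (simp add: \<gamma>'_def)
  qed
  ultimately show ?case
    using Suc.hyps(1)[of \<gamma>' \<xi>] st Suc.prems x
    by (metis \<gamma>'_def converse_rtranclp_into_rtranclp fun_upd_apply)
qed

section \<open>The burning algorithm and the converse criterion\<close>

definition sink_edges :: "nat \<Rightarrow> nat list set \<Rightarrow> nat list \<Rightarrow> nat" where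
  "sink_edges d V x = (if x \<in> V then d - card {y \<in> V. tree_adj x y} else 0)"

text \<open>Dhar's burning algorithm.  U is the set of vertices that have not toppled yet; a
  vertex of V that has toppled keeps its particles minus the edges into U.\<close>

lemma burning:
  assumes "allowed V {} \<eta>" "finite V" "V \<subseteq> tree_verts d" "U \<subseteq> V"
    "\<And>x. x \<in> V - U \<Longrightarrow> card {y \<in> U. tree_adj x y} \<le> \<eta> x"
  shows "(topple d V)\<^sup>*\<^sup>* (\<lambda>x. if x \<in> U then \<eta> x + d - card {y \<in> U. tree_adj x y}
     else if x \<in> V then \<eta> x - card {y \<in> U. tree_adj x y} else \<eta> x) \<eta>"
  using assms(4,5)
proof (induction "card U" arbitrary: U)
  case 0
  then have "U = {}" using assms(2) finite_subset by (metis card_eq_0_iff)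
  then show ?case by (simp cong: if_cong)
next
  case (Suc n)
  have fin: "finite U" using Suc.prems(1) assms(2) finite_subset by blast
  have ne: "U \<noteq> {}" by (metis Suc.hyps(2) card.empty nat.distinct(1))
  let ?c = "\<lambda>U x. if x \<in> U then \<eta> x + d - card {y \<in> U. tree_adj x y}
     else if x \<in> V then \<eta> x - card {y \<in> U. tree_adj x y} else \<eta> x"
  \<comment> \<open>The next vertex to burn: U is not forbidden, so some v holds at least as many
    particles as it has neighbours in U. This makes its current height at least d.\<close>
  obtain v where "v \<in> U" "card {y \<in> U. tree_adj v y} + card {y \<in> {} - V. child v y} \<le> \<eta> v"
    using assms(1) ne Suc.prems(1) unfolding allowed_def by meson
  then have v: "v \<in> U" "card {y \<in> U. tree_adj v y} \<le> \<eta> v" by simp_all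
  define U' where "U' = U - {v}"
  have card': "card {y \<in> U. tree_adj x y} = card {y \<in> U'. tree_adj x y} + (if tree_adj x v then 1 else 0)" for x
  proof (cases "tree_adj x v")
    case True
    then have "{y \<in> U. tree_adj x y} = insert v {y \<in> U'. tree_adj x y}" using v by (auto simp: U'_def)
    then show ?thesis using True fin by (simp add: U'_def)
  next
    case False
    then have "{y \<in> U. tree_adj x y} = {y \<in> U'. tree_adj x y}" by (auto simp: U'_def)
    then show ?thesis using False by simp
  qed
  have dg: "card {y \<in> U. tree_adj x y} \<le> d" if "x \<in> V" for x
    using degree_le[of U d x] Suc.prems(1) assms(3) that by blast
  define k k' where "k = (\<lambda>x. card {y \<in> U. tree_adj x y})" and "k' = (\<lambda>x. card {y \<in> U'. tree_adj x y})"
  have k: "k x = k' x + (if tree_adj v x then 1 else 0)" for x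
    using card'[of x] unfolding k_def k'_def tree_adj_sym[of v x] .
  have kd: "x \<in> V \<Longrightarrow> k x \<le> d" for x using dg by (simp add: k_def)
  have k\<eta>: "x \<in> V \<Longrightarrow> x \<notin> U \<Longrightarrow> k x \<le> \<eta> x" for x using Suc.prems(2) by (simp add: k_def)
  have vV: "v \<in> V" "k v \<le> \<eta> v" using v Suc.prems(1) by (auto simp: k_def)
  have step: "topple d V (\<lambda>x. if x \<in> U then \<eta> x + d - k x else if x \<in> V then \<eta> x - k x else \<eta> x)
    (\<lambda>x. if x \<in> U' then \<eta> x + d - k' x else if x \<in> V then \<eta> x - k' x else \<eta> x)"
    (is "topple d V ?a ?b")
    unfolding topple_def
  proof (intro bexI[of _ v] conjI ext)
    show "d \<le> ?a v" using v(1) vV by simp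
    fix y
    consider "y = v" | "y \<noteq> v" "y \<in> U" "y \<in> V" | "y \<notin> U" "y \<in> V" | "y \<notin> U" "y \<notin> V"
      using Suc.prems(1) by blast
    then show "?b y = (if y = v then ?a v - d else if y \<in> V \<and> tree_adj v y then ?a y + 1 else ?a y)"
    proof cases
      case 1
      then show ?thesis using k[of v] v(1) vV by (simp add: U'_def)
    next
      case 2
      have "?a y = \<eta> y + d - k y" "?b y = \<eta> y + d - k' y" using 2 by (simp_all add: U'_def)
      moreover have "\<eta> y + d - k' y = (if tree_adj v y then \<eta> y + d - k y + 1 else \<eta> y + d - k y)"
        using k[of y] kd[OF 2(3)] by (cases "tree_adj v y") auto
      ultimately show ?thesis using 2 by simp
    next
      case 3
      then have "y \<noteq> v" using v by blast
      then have "?a y = \<eta> y - k y" "?b y = \<eta> y - k' y" using 3 by (simp_all add: U'_def)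
      moreover have "\<eta> y - k' y = (if tree_adj v y then \<eta> y - k y + 1 else \<eta> y - k y)"
        using k[of y] k\<eta>[OF 3(2,1)] by (cases "tree_adj v y") auto
      ultimately show ?thesis using 3 \<open>y \<noteq> v\<close> by simp
    next
      case 4
      then have "y \<noteq> v" using v by blast
      with 4 show ?thesis by (simp add: U'_def)
    qed
  qed (rule vV)
  have "n = card U'" using Suc.hyps(2) v fin by (simp add: U'_def)
  moreover have "card {y \<in> U'. tree_adj x y} \<le> \<eta> x" if "x \<in> V - U'" for x
  proof (cases "x = v")
    case True
    then show ?thesis using v(2) card'[of v] by simp
  next
    case False
    then have "x \<in> V - U" using that by (auto simp: U'_def)
    then show ?thesis using Suc.prems(2)[of x] card'[of x] by linarith
  qed
  ultimately have "(topple d V)\<^sup>*\<^sup>* (?c U') \<eta>"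
    using Suc.hyps(1)[of U'] Suc.prems(1) by (auto simp: U'_def)
  with step[unfolded k_def k'_def] show ?case by (rule converse_rtranclp_into_rtranclp)
qed

text \<open>\<open>sink_edges\<close> is what a toppling of the sink would send out. Adding it to
  \<eta> gives the initial configuration of \<open>burning\<close> with U = V. The bound on the
  degree makes the truncated differences agree.\<close>

lemma add_sink_edges:
  assumes "allowed V {} \<eta>" "finite V" "V \<subseteq> tree_verts d"
  shows "(topple d V)\<^sup>*\<^sup>* (add_config \<eta> (sink_edges d V)) \<eta>"
proof -
  have "add_config \<eta> (sink_edges d V) = (\<lambda>x. if x \<in> V then \<eta> x + d - card {y \<in> V. tree_adj x y}
     else if x \<in> V then \<eta> x - card {y \<in> V. tree_adj x y} else \<eta> x)" (is "_ = ?c")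
  proof
    fix x
    show "add_config \<eta> (sink_edges d V) x = ?c x"
    proof (cases "x \<in> V")
      case True
      then have "card {y \<in> V. tree_adj x y} \<le> d" using degree_le[OF assms(3)] assms(3) by blast
      then show ?thesis using True by (simp add: add_config_def sink_edges_def)
    qed (simp add: add_config_def sink_edges_def)
  qed
  then show ?thesis using burning[OF assms order.refl] by simp
qed

text \<open>Such a \<gamma> supplies an inverse: if it contains a particle at x, the rest of
  \<gamma> undoes an addition at x.\<close>

definition addition_fixes :: "nat \<Rightarrow> nat list set \<Rightarrow> (nat list \<Rightarrow> nat) \<Rightarrow> (nat list \<Rightarrow> nat) \<Rightarrow> bool" where
  "addition_fixes d V \<eta> \<gamma> \<longleftrightarrow>
     (\<forall>y. y \<notin> V \<longrightarrow> \<gamma> y = 0) \<and> (topple d V)\<^sup>*\<^sup>* (add_config \<eta> \<gamma>) \<eta>"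

lemma addition_fixes_scale:
  assumes "addition_fixes d V \<eta> \<gamma>"
  shows "addition_fixes d V \<eta> (\<lambda>y. k * \<gamma> y)"
proof (induction k)
  case 0
  then show ?case by (simp add: addition_fixes_def add_config_def)
next
  case (Suc k)
  have "add_config \<eta> (\<lambda>y. Suc k * \<gamma> y) = add_config (add_config \<eta> \<gamma>) (\<lambda>y. k * \<gamma> y)"
    by (auto simp: add_config_def)
  moreover have "(topple d V)\<^sup>*\<^sup>* (add_config (add_config \<eta> \<gamma>) (\<lambda>y. k * \<gamma> y)) (add_config \<eta> (\<lambda>y. k * \<gamma> y))"
    using assms topple_rtranclp_add_config unfolding addition_fixes_def by blast
  ultimately show ?case using Suc assms unfolding addition_fixes_def
    by (metis (no_types, lifting) mult_0_right rtranclp_trans)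
qed

text \<open>If \<gamma> puts a particle at x then d times \<gamma> can topple at x, which puts one at every
  neighbour of x.\<close>

lemma addition_fixes_neighbour:
  assumes "addition_fixes d V \<eta> \<gamma>" "\<gamma> x > 0" "tree_adj x y" "x \<in> V" "y \<in> V" "\<eta> \<in> stable_configs d V"
  shows "\<exists>\<gamma>'. addition_fixes d V \<eta> \<gamma>' \<and> \<gamma>' y > 0"
proof -
  define g where "g = (\<lambda>y. d * \<gamma> y)"
  define \<gamma>' where "\<gamma>' = (\<lambda>y. if y = x then g x - d else if y \<in> V \<and> tree_adj x y then g y + 1 else g y)"
  have g: "addition_fixes d V \<eta> g" unfolding g_def by (rule addition_fixes_scale[OF assms(1)])
  have "d \<le> g x" using assms(2) by (simp add: g_def)
  then have "topple d V (add_config \<eta> g) (add_config \<eta> \<gamma>')"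
    using assms(4) unfolding topple_def add_config_def \<gamma>'_def
    by (intro bexI[of _ x] conjI ext) simp_all
  moreover have "terminal d V \<eta>" using assms(6) by (auto simp: stable_configs_def terminal_def)
  ultimately have "(topple d V)\<^sup>*\<^sup>* (add_config \<eta> \<gamma>') \<eta>"
    using topple_confluent g unfolding addition_fixes_def by blast
  moreover have "\<forall>y. y \<notin> V \<longrightarrow> \<gamma>' y = 0"
    using g assms(4) unfolding addition_fixes_def \<gamma>'_def by auto
  moreover have "\<gamma>' y > 0" using assms by (auto simp: \<gamma>'_def)
  ultimately show ?thesis unfolding addition_fixes_def by blast
qed

text \<open>Appending the letter 0 repeatedly to x leaves the finite set V. The last vertex before
  that has an edge to the sink, so \<open>sink_edges\<close> is positive there, and
  \<open>addition_fixes_neighbour\<close> carries positivity back up to x.\<close>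

lemma addition_fixes_exists:
  assumes "allowed V {} \<eta>" "\<eta> \<in> stable_configs d V" "finite V" "V \<subseteq> tree_verts d" "x \<in> V" "d \<ge> 2"
  shows "\<exists>\<gamma>. addition_fixes d V \<eta> \<gamma> \<and> \<gamma> x > 0"
  using assms(5)
proof (induction "card {y \<in> V. length y > length x}" arbitrary: x rule: less_induct)
  case less
  have t: "x @ [0] \<in> tree_verts d" using less.prems assms by (auto simp: snoc_in_tree_verts)
  show ?case
  proof (cases "x @ [0] \<in> V")
    case True
    have "{y \<in> V. length y > length (x @ [0])} \<subseteq> {y \<in> V. length y > length x}" by auto
    moreover have "x @ [0] \<in> {y \<in> V. length y > length x}" using True by simp
    moreover have "x @ [0] \<notin> {y \<in> V. length y > length (x @ [0])}" by simp
    ultimately have "{y \<in> V. length y > length (x @ [0])} \<subset> {y \<in> V. length y > length x}" by blast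
    then have "card {y \<in> V. length y > length (x @ [0])} < card {y \<in> V. length y > length x}"
      using assms(3) by (intro psubset_card_mono) auto
    then obtain \<gamma> where "addition_fixes d V \<eta> \<gamma>" "\<gamma> (x @ [0]) > 0" using less.hyps True by blast
    then show ?thesis using addition_fixes_neighbour[of d V \<eta> \<gamma> "x @ [0]" x] True less.prems assms(2)
      by (auto simp: tree_adj_def)
  next
    case False
    have "tree_adj x (x @ [0])" by (simp add: tree_adj_def)
    then have *: "{y \<in> V. tree_adj x y} \<subset> {y \<in> tree_verts d. tree_adj x y}"
      using False t assms(4) by blast
    have "x \<in> tree_verts d" using less.prems assms(4) by blast
    from neighbours_tree_verts[OF this] have "card {y \<in> V. tree_adj x y} < d"
      using psubset_card_mono[OF _ *] by linarith
    then have "sink_edges d V x > 0" using less.prems by (simp add: sink_edges_def)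
    moreover have "addition_fixes d V \<eta> (sink_edges d V)"
      using add_sink_edges[OF assms(1,3,4)] by (simp add: addition_fixes_def sink_edges_def)
    ultimately show ?thesis by blast
  qed
qed

text \<open>Choose \<gamma> that fixes \<eta> and contains a particle at the vertex x of the step.
  Its other particles, added after the step, lead back to \<eta> by confluence.\<close>

lemma chain_step_reversible:
  assumes "allowed V {} \<eta>" "\<eta> \<in> stable_configs d V" "finite V" "V \<subseteq> tree_verts d" "d \<ge> 2"
    and "chain_step d V \<eta> \<zeta>"
  shows "(chain_step d V)\<^sup>*\<^sup>* \<zeta> \<eta>"
proof -
  obtain x where x: "x \<in> V" "(topple d V)\<^sup>*\<^sup>* (\<eta>(x := \<eta> x + 1)) \<zeta>" "\<zeta> \<in> stable_configs d V"
    using assms(6) unfolding chain_step_def by blast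
  obtain \<gamma> where g: "addition_fixes d V \<eta> \<gamma>" "\<gamma> x > 0"
    using addition_fixes_exists assms x(1) by blast
  define \<gamma>' where "\<gamma>' = \<gamma>(x := \<gamma> x - 1)"
  have eq: "add_config \<eta> \<gamma> = add_config (\<eta>(x := \<eta> x + 1)) \<gamma>'"
    using g(2) by (auto simp: add_config_def \<gamma>'_def fun_eq_iff)
  have "terminal d V \<eta>" using assms(2) by (auto simp: stable_configs_def terminal_def)
  then have "(topple d V)\<^sup>*\<^sup>* (add_config \<zeta> \<gamma>') \<eta>"
    using topple_confluent topple_rtranclp_add_config[OF x(2), of \<gamma>'] g(1)
    unfolding addition_fixes_def eq by blast
  moreover have "\<And>y. y \<notin> V \<Longrightarrow> \<gamma>' y = 0" using g(1) x(1) by (auto simp: addition_fixes_def \<gamma>'_def)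
  ultimately show ?thesis
    using chain_of_add_config[OF _ x(3) assms(2,3)] by blast
qed

text \<open>For the converse, a path of the chain from an allowed configuration stays among allowed
  ones, so it can be reversed step by step.\<close>

lemma recurrent_configs_eq:
  assumes "finite V" "V \<subseteq> tree_verts d" "d \<ge> 2"
  shows "recurrent_configs d V = {\<eta> \<in> stable_configs d V. allowed V {} \<eta>}"
proof (intro equalityI subsetI)
  fix \<eta> assume "\<eta> \<in> recurrent_configs d V"
  then show "\<eta> \<in> {\<eta> \<in> stable_configs d V. allowed V {} \<eta>}"
    using recurrent_imp_allowed assms by (auto simp: recurrent_configs_def)
next
  fix \<eta> assume e: "\<eta> \<in> {\<eta> \<in> stable_configs d V. allowed V {} \<eta>}"
  have "\<zeta> \<in> stable_configs d V \<and> allowed V {} \<zeta> \<and> (chain_step d V)\<^sup>*\<^sup>* \<zeta> \<eta>"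
    if "(chain_step d V)\<^sup>*\<^sup>* \<eta> \<zeta>" for \<zeta>
    using that
  proof (induction rule: rtranclp_induct)
    case (step \<xi> \<zeta>)
    have "\<zeta> \<in> stable_configs d V" using step by (auto simp: chain_step_def)
    moreover have "allowed V {} \<zeta>" using step chain_step_allowed assms by blast
    moreover have "(chain_step d V)\<^sup>*\<^sup>* \<zeta> \<xi>" using chain_step_reversible step assms by blast
    ultimately show ?case using step by (meson rtranclp_trans)
  qed (use e in auto)
  then show "\<eta> \<in> recurrent_configs d V" using e by (auto simp: recurrent_configs_def)
qed

subsection \<open>Sums over independent random subsets\<close>

text \<open>The expectation of g J when each c in D belongs to J independently with probability \<rho> c.\<close>

definition bern_sum :: "'a set \<Rightarrow> ('a \<Rightarrow> real) \<Rightarrow> ('a set \<Rightarrow> real) \<Rightarrow> real" where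
  "bern_sum D \<rho> g = (\<Sum>J\<in>Pow D. (\<Prod>c\<in>J. \<rho> c) * (\<Prod>c\<in>D - J. 1 - \<rho> c) * g J)"

lemma bern_sum_cong:
  assumes "\<And>J. J \<subseteq> D \<Longrightarrow> g J = h J"
  shows "bern_sum D \<rho> g = bern_sum D \<rho> h"
  using assms by (auto simp: bern_sum_def intro!: sum.cong)

lemma bern_sum_add: "bern_sum D \<rho> (\<lambda>J. g J + h J) = bern_sum D \<rho> g + bern_sum D \<rho> h"
  by (simp add: bern_sum_def sum.distrib distrib_left)

lemma bern_sum_cmult: "bern_sum D \<rho> (\<lambda>J. k * g J) = k * bern_sum D \<rho> g"
  by (simp add: bern_sum_def sum_distrib_left mult_ac)

lemma bern_sum_diff: "bern_sum D \<rho> (\<lambda>J. g J - h J) = bern_sum D \<rho> g - bern_sum D \<rho> h"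
  by (simp add: bern_sum_def sum_subtractf right_diff_distrib)

lemma bern_sum_sum: "bern_sum D \<rho> (\<lambda>J. \<Sum>i\<in>I. g i J) = (\<Sum>i\<in>I. bern_sum D \<rho> (g i))"
  unfolding bern_sum_def sum_distrib_left by (rule sum.swap)

lemma bern_sum_insert:
  assumes "finite D" "c \<notin> D"
  shows "bern_sum (insert c D) \<rho> g
    = \<rho> c * bern_sum D \<rho> (\<lambda>J. g (insert c J)) + (1 - \<rho> c) * bern_sum D \<rho> g"
proof -
  let ?w = "\<lambda>J. (\<Prod>c\<in>J. \<rho> c) * (\<Prod>c\<in>insert c D - J. 1 - \<rho> c) * g J"
  have disj: "Pow D \<inter> insert c ` Pow D = {}" using assms(2) by blast
  have inj: "inj_on (insert c) (Pow D)" using assms(2) by (auto simp: inj_on_def)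
  have "bern_sum (insert c D) \<rho> g = sum ?w (Pow D) + sum ?w (insert c ` Pow D)"
    unfolding bern_sum_def Pow_insert using assms(1) disj by (intro sum.union_disjoint) auto
  also have "sum ?w (insert c ` Pow D) = (\<Sum>J\<in>Pow D. ?w (insert c J))"
    using inj by (simp add: sum.reindex)
  also have "\<dots> = \<rho> c * bern_sum D \<rho> (\<lambda>J. g (insert c J))"
    unfolding bern_sum_def sum_distrib_left
  proof (rule sum.cong)
    fix J assume "J \<in> Pow D"
    then have J: "finite J" "c \<notin> J" using assms finite_subset by auto
    have "insert c D - insert c J = D - J" using assms J by auto
    then show "?w (insert c J) = \<rho> c * (prod \<rho> J * (\<Prod>c\<in>D - J. 1 - \<rho> c) * g (insert c J))"
      using J by simp
  qed simp
  also have "sum ?w (Pow D) = (1 - \<rho> c) * bern_sum D \<rho> g"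
    unfolding bern_sum_def sum_distrib_left
  proof (rule sum.cong)
    fix J assume "J \<in> Pow D"
    then have J: "insert c D - J = insert c (D - J)" "c \<notin> D - J" using assms by auto
    then show "?w J = (1 - \<rho> c) * (prod \<rho> J * (\<Prod>c\<in>D - J. 1 - \<rho> c) * g J)"
      using assms(1) by simp
  qed simp
  finally show ?thesis by simp
qed

text \<open>Conditioning on the mark at c with the index set D kept. Thus the marks can always be
  summed over all of V while vertices are removed from the configuration.\<close>

lemma bern_sum_split:
  assumes "finite D" "c \<in> D"
  shows "bern_sum D \<rho> g
    = \<rho> c * bern_sum D \<rho> (\<lambda>J. g (insert c J)) + (1 - \<rho> c) * bern_sum D \<rho> (\<lambda>J. g (J - {c}))"
proof -
  define E where "E = D - {c}"
  have D: "D = insert c E" "finite E" "c \<notin> E" using assms by (auto simp: E_def)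
  have "bern_sum E \<rho> (\<lambda>J. g (J - {c})) = bern_sum E \<rho> g"
    using D(3) by (intro bern_sum_cong) (metis Diff_empty Diff_insert0 subsetD)
  then show ?thesis
    unfolding D(1) bern_sum_insert[OF D(2,3)] using D(3)
    by (simp add: algebra_simps)
qed

text \<open>Independence of the mark at c from a quantity that ignores it.\<close>

lemma bern_sum_indicator:
  assumes "finite D" "c \<in> D" "\<And>J. J \<subseteq> D \<Longrightarrow> g (insert c J) = g J"
  shows "bern_sum D \<rho> (\<lambda>J. of_bool (c \<in> J) * g J) = \<rho> c * bern_sum D \<rho> g"
proof -
  define E where "E = D - {c}"
  have D: "D = insert c E" "finite E" "c \<notin> E" using assms by (auto simp: E_def)
  have "bern_sum E \<rho> (\<lambda>J. of_bool (c \<in> J) * g J) = bern_sum E \<rho> (\<lambda>J. 0 * g J)"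
    using D(3) by (intro bern_sum_cong) auto
  then have "bern_sum E \<rho> (\<lambda>J. of_bool (c \<in> J) * g J) = 0" unfolding bern_sum_cmult by simp
  moreover have "bern_sum E \<rho> (\<lambda>J. g (insert c J)) = bern_sum E \<rho> g"
    using D(1) assms(3) by (intro bern_sum_cong) auto
  ultimately show ?thesis
    unfolding D(1) bern_sum_insert[OF D(2,3)] by (simp add: algebra_simps)
qed

lemma bern_sum_restrict:
  assumes "finite D" "D' \<subseteq> D" "\<And>J. J \<subseteq> D \<Longrightarrow> g J = g (J \<inter> D')"
  shows "bern_sum D \<rho> g = bern_sum D' \<rho> g"
proof -
  have "bern_sum (D' \<union> S) \<rho> g = bern_sum D' \<rho> g" if "finite S" "S \<subseteq> D - D'" for S
    using that
  proof (induction S rule: finite_induct)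
    case (insert c S)
    have fin: "finite (D' \<union> S)" using insert assms finite_subset by auto
    have c: "c \<notin> D' \<union> S" using insert by auto
    have "g (insert c J) = g J" if "J \<subseteq> D' \<union> S" for J
    proof -
      have "insert c J \<subseteq> D" "J \<subseteq> D" using that insert assms(2) by auto
      moreover have "insert c J \<inter> D' = J \<inter> D'" using c by auto
      ultimately show ?thesis using assms(3) by metis
    qed
    then have "bern_sum (D' \<union> S) \<rho> (\<lambda>J. g (insert c J)) = bern_sum (D' \<union> S) \<rho> g"
      by (intro bern_sum_cong)
    then have "bern_sum (insert c (D' \<union> S)) \<rho> g = bern_sum (D' \<union> S) \<rho> g"
      unfolding bern_sum_insert[OF fin c] by (simp add: algebra_simps)
    then show ?case using insert by simp
  qed simp
  from this[of "D - D'"] show ?thesis using assms(1,2) by (simp add: Un_absorb1)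
qed

lemma bern_sum_nonneg:
  assumes "\<And>c. c \<in> D \<Longrightarrow> 0 \<le> \<rho> c \<and> \<rho> c \<le> 1" "\<And>J. J \<subseteq> D \<Longrightarrow> 0 \<le> g J"
  shows "0 \<le> bern_sum D \<rho> g"
  unfolding bern_sum_def using assms
  by (intro sum_nonneg mult_nonneg_nonneg prod_nonneg) auto

text \<open>The term J = {} alone is positive, since its weight is a product of the positive numbers
  1 - \<rho> c.\<close>

lemma bern_sum_pos:
  assumes "finite D" "\<And>c. c \<in> D \<Longrightarrow> 0 \<le> \<rho> c \<and> \<rho> c < 1" "\<And>J. J \<subseteq> D \<Longrightarrow> 0 \<le> g J" "g {} > 0"
  shows "0 < bern_sum D \<rho> g"
proof -
  have "0 < (\<Prod>c\<in>D. 1 - \<rho> c) * g {}"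
    using assms by (intro mult_pos_pos prod_pos) auto
  also have "\<dots> = (\<Sum>J\<in>{{}}. (\<Prod>c\<in>J. \<rho> c) * (\<Prod>c\<in>D - J. 1 - \<rho> c) * g J)" by simp
  also have "\<dots> \<le> bern_sum D \<rho> g"
    unfolding bern_sum_def using assms
    by (intro sum_mono2 mult_nonneg_nonneg prod_nonneg) (auto simp: less_imp_le)
  finally show ?thesis .
qed

lemma tendsto_bern_sum:
  assumes "\<And>c. c \<in> D \<Longrightarrow> (\<lambda>n. \<rho> n c) \<longlonglongrightarrow> \<rho>' c"
  shows "(\<lambda>n. bern_sum D (\<rho> n) g) \<longlonglongrightarrow> bern_sum D \<rho>' g"
  unfolding bern_sum_def
  by (intro tendsto_sum tendsto_mult tendsto_prod tendsto_diff tendsto_const assms) auto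

section \<open>The place of a leaf in the burning order\<close>

text \<open>The only possible neighbour of v in W is its parent u, and k marked children count
  against v. With fewer than k particles {v} is forbidden; with more than k, v satisfies the
  condition in every F; with exactly k it does so only when u is not in F, so it burns after u and
  acts as a mark on u. Whether v lies in J matters only once v has left W, hence the removal or
  insertion.\<close>

lemma allowed_insert_leaf:
  assumes "v \<in> W" "\<And>y. y \<in> W \<Longrightarrow> \<not> child v y" "finite W" "v = u @ [a]" "finite J"
  defines "k \<equiv> card {y \<in> J - W. child v y}"
  shows "allowed W J \<eta> \<longleftrightarrow> (k < \<eta> v \<and> allowed (W - {v}) (J - {v}) \<eta>)
    \<or> (k = \<eta> v \<and> allowed (W - {v}) (insert v J) \<eta>)"
proof -
  have uv: "child x v \<longleftrightarrow> x = u" for x using assms(4) by (auto simp: child_def)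
  have adjv: "tree_adj v x \<longleftrightarrow> x = u" if "x \<in> W" for x
    using assms(2) that uv by (auto simp: tree_adj_child)
  have adjv': "tree_adj x v \<longleftrightarrow> x = u" if "x \<in> W" for x
    using adjv that tree_adj_sym by blast
  have degv: "card {y \<in> F. tree_adj v y} = of_bool (u \<in> F)" if "F \<subseteq> W" for F
  proof -
    have "{y \<in> F. tree_adj v y} = (if u \<in> F then {u} else {})" using adjv that by auto
    then show ?thesis by simp
  qed
  have deg: "card {y \<in> F. tree_adj x y} = card {y \<in> F - {v}. tree_adj x y} + of_bool (x = u)"
    if "F \<subseteq> W" "v \<in> F" "x \<in> F" for F x
  proof (cases "x = u")
    case True
    then have "{y \<in> F. tree_adj x y} = insert v {y \<in> F - {v}. tree_adj x y}"
      using adjv' that by auto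
    moreover have "finite F" using that(1) assms(3) finite_subset by blast
    ultimately show ?thesis using True by simp
  next
    case False
    then have "{y \<in> F. tree_adj x y} = {y \<in> F - {v}. tree_adj x y}"
      using adjv' that by auto
    then show ?thesis using False by simp
  qed
  define n where "n F x = card {y \<in> F. tree_adj x y}" for F x
  define j where "j x = card {y \<in> J - W. child x y}" for x
  have L: "allowed W J \<eta> \<longleftrightarrow> (\<forall>F\<subseteq>W. F \<noteq> {} \<longrightarrow> (\<exists>x\<in>F. n F x + j x \<le> \<eta> x))"
    by (simp add: allowed_def n_def j_def)
  have "J - {v} - (W - {v}) = J - W" using assms(1) by blast
  then have A: "allowed (W - {v}) (J - {v}) \<eta> \<longleftrightarrow>
      (\<forall>F\<subseteq>W - {v}. F \<noteq> {} \<longrightarrow> (\<exists>x\<in>F. n F x + j x \<le> \<eta> x))"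
    unfolding allowed_def n_def j_def by simp
  have j': "card {y \<in> insert v J - (W - {v}). child x y} = j x + of_bool (x = u)" for x
  proof (cases "x = u")
    case True
    then have "{y \<in> insert v J - (W - {v}). child x y} = insert v {y \<in> J - W. child x y}"
      using uv by auto
    then show ?thesis using True assms(1,5) by (simp add: j_def)
  next
    case False
    then have "{y \<in> insert v J - (W - {v}). child x y} = {y \<in> J - W. child x y}"
      using uv by auto
    then show ?thesis using False by (simp add: j_def)
  qed
  have B: "allowed (W - {v}) (insert v J) \<eta> \<longleftrightarrow>
      (\<forall>F\<subseteq>W - {v}. F \<noteq> {} \<longrightarrow> (\<exists>x\<in>F. n F x + (j x + of_bool (x = u)) \<le> \<eta> x))"
    unfolding allowed_def n_def j' ..
  have kj: "k = j v" by (simp add: k_def j_def)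
  have nv: "n F v = of_bool (u \<in> F)" if "F \<subseteq> W" for F using degv[OF that] by (simp add: n_def)
  have nx: "n F x = n (F - {v}) x + of_bool (x = u)" if "F \<subseteq> W" "v \<in> F" "x \<in> F" for F x
    using deg[OF that] by (simp only: n_def)
  consider "\<eta> v < k" | "k < \<eta> v" | "k = \<eta> v" by linarith
  then show ?thesis
  proof cases
    case 1
    have "\<not> (\<exists>x\<in>{v}. n {v} x + j x \<le> \<eta> x)" using 1 kj by simp
    moreover have "{v} \<subseteq> W" "{v} \<noteq> {}" using assms(1) by simp_all
    ultimately have "\<not> allowed W J \<eta>" unfolding L by meson
    with 1 show ?thesis by simp
  next
    case 2
    have "\<exists>x\<in>F. n F x + j x \<le> \<eta> x"
      if H: "\<forall>F\<subseteq>W - {v}. F \<noteq> {} \<longrightarrow> (\<exists>x\<in>F. n F x + j x \<le> \<eta> x)" and F: "F \<subseteq> W" "F \<noteq> {}" for F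
    proof (cases "v \<in> F")
      case True
      have "n F v + j v \<le> \<eta> v" using nv[OF F(1)] 2 kj by simp
      with True show ?thesis by blast
    next
      case False
      then have "F \<subseteq> W - {v}" using F(1) by blast
      then show ?thesis using H F(2) by blast
    qed
    then have "allowed W J \<eta> \<longleftrightarrow> allowed (W - {v}) (J - {v}) \<eta>"
      unfolding L A by (meson Diff_subset subset_trans)
    with 2 show ?thesis by simp
  next
    case 3
    have 31: "\<exists>x\<in>F. n F x + (j x + of_bool (x = u)) \<le> \<eta> x"
      if H: "\<forall>F\<subseteq>W. F \<noteq> {} \<longrightarrow> (\<exists>x\<in>F. n F x + j x \<le> \<eta> x)" and F: "F \<subseteq> W - {v}" "F \<noteq> {}" for F
    proof (cases "u \<in> F")
      case True
      \<comment> \<open>With its parent in the set, v would need k + 1 particles and has k. So the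
        witness for the enlarged set lies in F, and if it is u, then v is counted among its
        neighbours.\<close>
      let ?F = "insert v F"
      have sub: "?F \<subseteq> W" using F assms(1) by blast
      then obtain x where x: "x \<in> ?F" "n ?F x + j x \<le> \<eta> x" using H by blast
      have "x \<noteq> v" using x(2) nv[OF sub] True 3 kj by auto
      then have "x \<in> F" using x(1) by blast
      moreover have "?F - {v} = F" using F by blast
      then have "n ?F x = n F x + of_bool (x = u)" using nx[OF sub _ x(1)] by simp
      ultimately show ?thesis using x(2) by (intro bexI[of _ x]) simp_all
    next
      case False
      have "F \<subseteq> W" using F by blast
      then obtain x where x: "x \<in> F" "n F x + j x \<le> \<eta> x" using H F(2) by blast
      then have "x \<noteq> u" using False by blast
      then show ?thesis using x by (intro bexI[of _ x]) simp_all
    qed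
    have 32: "\<exists>x\<in>F. n F x + j x \<le> \<eta> x"
      if H: "\<forall>F\<subseteq>W - {v}. F \<noteq> {} \<longrightarrow> (\<exists>x\<in>F. n F x + (j x + of_bool (x = u)) \<le> \<eta> x)"
        and F: "F \<subseteq> W" "F \<noteq> {}" for F
    proof (cases "v \<in> F \<and> u \<notin> F")
      case True
      then have "n F v + j v \<le> \<eta> v" using nv[OF F(1)] 3 kj by simp
      with True show ?thesis by blast
    next
      case False
      \<comment> \<open>This rules out F = {v}: if v is in F then so is u, a different
        vertex.\<close>
      have "u \<noteq> v" using assms(4) by simp
      then have "F - {v} \<subseteq> W - {v}" "F - {v} \<noteq> {}" using False F by blast+
      then obtain x where x: "x \<in> F - {v}" "n (F - {v}) x + (j x + of_bool (x = u)) \<le> \<eta> x"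
        using H by blast
      have "n F x + j x \<le> \<eta> x"
      proof (cases "v \<in> F")
        case True
        have "x \<in> F" using x(1) by blast
        then show ?thesis using nx[OF F(1) True] x(2) by simp
      next
        case False
        then have "F - {v} = F" by blast
        then show ?thesis using x(2) by simp
      qed
      with x(1) show ?thesis by blast
    qed
    have "allowed W J \<eta> \<longleftrightarrow> allowed (W - {v}) (insert v J) \<eta>"
      unfolding L B using 31 32 by meson
    with 3 show ?thesis by simp
  qed
qed

subsection \<open>Counting recurrent configurations by removing leaves\<close>

lemma finite_stable_configs:
  assumes "finite V"
  shows "finite (stable_configs d V)"
proof -
  have "stable_configs d V \<subseteq> {f. \<forall>x. (x \<in> V \<longrightarrow> f x \<in> {..<d}) \<and> (x \<notin> V \<longrightarrow> f x = 0)}"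
    by (auto simp: stable_configs_def)
  then show ?thesis using finite_set_of_finite_funs[OF assms, of "{..<d}" 0] finite_subset by blast
qed

lemma allowed_cong:
  assumes "\<And>x. x \<in> W \<Longrightarrow> \<eta> x = \<zeta> x"
    and "\<And>x y. x \<in> W \<Longrightarrow> y \<notin> W \<Longrightarrow> child x y \<Longrightarrow> y \<in> J \<longleftrightarrow> y \<in> K"
  shows "allowed W J \<eta> \<longleftrightarrow> allowed W K \<zeta>"
proof -
  have "{y \<in> J - W. child x y} = {y \<in> K - W. child x y}" if "x \<in> W" for x
    using assms(2)[OF that] by blast
  then have "card {y \<in> J - W. child x y} = card {y \<in> K - W. child x y}" if "x \<in> W" for x
    using that by metis
  then have "(\<exists>x\<in>F. card {y \<in> F. tree_adj x y} + card {y \<in> J - W. child x y} \<le> \<eta> x) \<longleftrightarrow>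
      (\<exists>x\<in>F. card {y \<in> F. tree_adj x y} + card {y \<in> K - W. child x y} \<le> \<zeta> x)" if "F \<subseteq> W" for F
    using assms(1) that by (intro bex_cong) (auto simp: subset_iff)
  then show ?thesis by (simp add: allowed_def)
qed

text \<open>The prescription q on B is carried through all removals, so that the factors can be seen
  not to depend on it.\<close>

definition allowed_configs ::
    "nat \<Rightarrow> nat list set \<Rightarrow> (nat list \<Rightarrow> nat) \<Rightarrow> nat list set \<Rightarrow> nat list set \<Rightarrow> (nat list \<Rightarrow> nat) set" where
  "allowed_configs d B q W J = {\<eta> \<in> stable_configs d W. (\<forall>x\<in>B. \<eta> x = q x) \<and> allowed W J \<eta>}"

lemma allowed_configs_cong:
  assumes "\<And>x y. x \<in> W \<Longrightarrow> y \<notin> W \<Longrightarrow> child x y \<Longrightarrow> y \<in> J \<longleftrightarrow> y \<in> K"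
  shows "allowed_configs d B q W J = allowed_configs d B q W K"
proof -
  have "allowed W J \<eta> \<longleftrightarrow> allowed W K \<eta>" for \<eta>
    by (rule allowed_cong[OF refl assms])
  then show ?thesis by (simp add: allowed_configs_def)
qed

text \<open>The value at v is free because v is outside B. The d - 1 - k values above the number k
  of marked children leave v unmarked, the value k marks it, and smaller values contribute
  nothing.\<close>

lemma card_allowed_configs_remove:
  assumes "finite W" "v \<in> W" "v = u @ [a]" "v \<in> tree_verts d" "v \<notin> B"
    and "\<And>y. y \<in> W \<Longrightarrow> \<not> child v y" "finite J" "J \<subseteq> tree_verts d"
  shows "real (card (allowed_configs d B q W J))
    = (real d - 1 - (\<Sum>b<d - 1. of_bool (v @ [b] \<in> J))) * card (allowed_configs d B q (W - {v}) (J - {v}))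
      + card (allowed_configs d B q (W - {v}) (insert v J))"
proof -
  define k where "k = card {y \<in> J - W. child v y}"
  have "{y \<in> J - W. child v y} = (\<lambda>b. v @ [b]) ` {b \<in> {..<d - 1}. v @ [b] \<in> J}"
  proof -
    have "b < d - 1" if "v @ [b] \<in> J" for b
      using that assms(3,8) snoc_in_tree_verts[of v b d] by auto
    then show ?thesis using assms(6) by (auto simp: child_def)
  qed
  then have k': "k = card {b \<in> {..<d - 1}. v @ [b] \<in> J}"
    unfolding k_def by (simp add: card_image inj_on_def)
  have k: "real k = (\<Sum>b<d - 1. of_bool (v @ [b] \<in> J))"
    unfolding k' by (simp add: Int_def)
  have "k \<le> d - 1"
    unfolding k' using card_mono[of "{..<d - 1}" "{b \<in> {..<d - 1}. v @ [b] \<in> J}"] by auto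
  moreover have "d > 0" using assms(3,4) snoc_in_tree_verts[of u a d] by (auto split: if_splits)
  ultimately have kd: "k < d" by simp
  define X where "X = {\<xi> \<in> stable_configs d (W - {v}). \<forall>x\<in>B. \<xi> x = q x}"
  define Y where "Y = {\<eta> \<in> stable_configs d W. \<forall>x\<in>B. \<eta> x = q x}"
  have fin: "finite X" "finite Y" using finite_stable_configs assms(1) by (auto simp: X_def Y_def)
  have cardY: "real (card (allowed_configs d B q W J)) = (\<Sum>\<eta>\<in>Y. of_bool (allowed W J \<eta>))"
  proof -
    have "allowed_configs d B q W J = Y \<inter> {\<eta>. allowed W J \<eta>}"
      by (auto simp: allowed_configs_def Y_def)
    then show ?thesis using fin by simp
  qed
  have cardX: "real (card (allowed_configs d B q (W - {v}) K)) = (\<Sum>\<xi>\<in>X. of_bool (allowed (W - {v}) K \<xi>))" for K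
  proof -
    have "allowed_configs d B q (W - {v}) K = X \<inter> {\<eta>. allowed (W - {v}) K \<eta>}"
      by (auto simp: allowed_configs_def X_def)
    then show ?thesis using fin by simp
  qed
  have leaf: "allowed W J (\<xi>(v := i)) \<longleftrightarrow> (k < i \<and> allowed (W - {v}) (J - {v}) \<xi>)
      \<or> (k = i \<and> allowed (W - {v}) (insert v J) \<xi>)" for \<xi> i
  proof -
    have "allowed (W - {v}) K (\<xi>(v := i)) \<longleftrightarrow> allowed (W - {v}) K \<xi>" for K
      by (rule allowed_cong) auto
    then show ?thesis
      using allowed_insert_leaf[OF assms(2,6,1,3,7), of "\<xi>(v := i)"] by (simp add: k_def)
  qed
  have count: "(\<Sum>i<d. of_bool (allowed W J (\<xi>(v := i))))
      = (real d - 1 - k) * of_bool (allowed (W - {v}) (J - {v}) \<xi>) + of_bool (allowed (W - {v}) (insert v J) \<xi>)" for \<xi>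
  proof -
    have "of_bool (allowed W J (\<xi>(v := i)))
       = of_bool (k < i) * of_bool (allowed (W - {v}) (J - {v}) \<xi>)
         + (if k = i then of_bool (allowed (W - {v}) (insert v J) \<xi>) else (0::real))" for i
      unfolding leaf by (cases "k < i"; cases "k = i") auto
    then have "(\<Sum>i<d. of_bool (allowed W J (\<xi>(v := i))))
       = (\<Sum>i<d. of_bool (k < i)) * of_bool (allowed (W - {v}) (J - {v}) \<xi>)
         + (\<Sum>i<d. if k = i then of_bool (allowed (W - {v}) (insert v J) \<xi>) else (0::real))"
      by (simp only: sum.distrib sum_distrib_right)
    moreover have "(\<Sum>i<d. of_bool (k < i)) = real d - 1 - k"
    proof -
      have "{..<d} \<inter> {i. k < i} = {k<..<d}" by auto
      then show ?thesis using kd by (simp add: of_nat_diff)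
    qed
    ultimately show ?thesis using kd by simp
  qed
  \<comment> \<open>A configuration on W is a configuration on \<open>W - {v}\<close> together with
    the value at v; the entry at v is reset to 0, the default outside the support.\<close>
  have "(\<Sum>\<eta>\<in>Y. of_bool (allowed W J \<eta>)) = (\<Sum>(\<xi>, i)\<in>X \<times> {..<d}. of_bool (allowed W J (\<xi>(v := i))) :: real)"
  proof (rule sum.reindex_bij_witness[of _ "\<lambda>(\<xi>, i). \<xi>(v := i)" "\<lambda>\<eta>. (\<eta>(v := 0), \<eta> v)"])
    fix \<eta> assume "\<eta> \<in> Y"
    then show "(\<eta>(v := 0), \<eta> v) \<in> X \<times> {..<d}"
      using assms(2,5) by (auto simp: X_def Y_def stable_configs_def)
  next
    fix z assume "z \<in> X \<times> {..<d}"
    then obtain \<xi> i where z: "z = (\<xi>, i)" "\<xi> \<in> X" "i < d" by blast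
    then have "\<xi> v = 0" by (simp add: X_def stable_configs_def)
    then show "(\<lambda>\<eta>. (\<eta>(v := 0), \<eta> v)) (case z of (\<xi>, i) \<Rightarrow> \<xi>(v := i)) = z"
      using z(1) by (auto simp: fun_eq_iff)
    show "(case z of (\<xi>, i) \<Rightarrow> \<xi>(v := i)) \<in> Y"
      using z assms(2,5) by (auto simp: X_def Y_def stable_configs_def)
  qed auto
  also have "\<dots> = (\<Sum>\<xi>\<in>X. \<Sum>i<d. of_bool (allowed W J (\<xi>(v := i))))"
    by (simp only: sum.cartesian_product)
  also have "\<dots> = (real d - 1 - k) * card (allowed_configs d B q (W - {v}) (J - {v}))
      + card (allowed_configs d B q (W - {v}) (insert v J))"
    unfolding count cardX sum.distrib sum_distrib_left by simp
  finally show ?thesis unfolding cardY k .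
qed

text \<open>The probability that a branch rooted at a vertex of V burns only after the parent of
  that vertex has burnt.\<close>

function weak_prob :: "nat \<Rightarrow> nat list set \<Rightarrow> nat list \<Rightarrow> real" where
  "weak_prob d V c = (if finite V \<and> c \<in> V then 1 / (real d - (\<Sum>b<d - 1. weak_prob d V (c @ [b]))) else 0)"
  by auto
termination
\<comment> \<open>Among the finitely many vertices of V at least as long as the argument, c itself
  drops out when passing to a child.\<close>
proof (relation "Wellfounded.measure (\<lambda>(d, V, c). card {y \<in> V. length c \<le> length y})")
  fix d b :: nat and V :: "nat list set" and c
  assume *: "finite V \<and> c \<in> V"
  have "{y \<in> V. length (c @ [b]) \<le> length y} \<subseteq> {y \<in> V. length c \<le> length y}" by auto
  moreover have "c \<in> {y \<in> V. length c \<le> length y}" using * by simp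
  moreover have "c \<notin> {y \<in> V. length (c @ [b]) \<le> length y}" by simp
  ultimately have "{y \<in> V. length (c @ [b]) \<le> length y} \<subset> {y \<in> V. length c \<le> length y}" by blast
  then show "((d, V, c @ [b]), d, V, c) \<in> Wellfounded.measure (\<lambda>(d, V, c). card {y \<in> V. length c \<le> length y})"
    using * by (simp add: psubset_card_mono)
qed simp

declare weak_prob.simps [simp del]

lemma sum_le_one_of_le:
  assumes "\<And>b. b < n \<Longrightarrow> 0 \<le> f b \<and> f b \<le> 1 / real n"
  shows "0 \<le> (\<Sum>b<n. f b) \<and> (\<Sum>b<n. f b) \<le> 1"
proof
  have "(\<Sum>b<n. f b) \<le> (\<Sum>b<n. 1 / real n)" using assms by (intro sum_mono) auto
  then show "(\<Sum>b<n. f b) \<le> 1" by (cases "n = 0") auto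
qed (use assms in \<open>auto intro: sum_nonneg\<close>)

text \<open>The bound reproduces itself: d - 1 children with at most 1 / (d - 1) each have sum at
  most 1, so the denominator is at least d - 1.\<close>

lemma weak_prob_bounds:
  assumes "d \<ge> 2"
  shows "0 \<le> weak_prob d V c \<and> weak_prob d V c \<le> 1 / real (d - 1)"
  using assms
proof (induction d V c rule: weak_prob.induct)
  case (1 d V c)
  show ?case
  proof (cases "finite V \<and> c \<in> V")
    case True
    let ?s = "\<Sum>b<d - 1. weak_prob d V (c @ [b])"
    have "0 \<le> ?s \<and> ?s \<le> 1" using 1 True by (intro sum_le_one_of_le) auto
    then have "real (d - 1) \<le> real d - ?s" using 1(2) by (simp add: of_nat_diff)
    moreover have "0 < real (d - 1)" using 1(2) by simp
    ultimately have "0 \<le> 1 / (real d - ?s) \<and> 1 / (real d - ?s) \<le> 1 / real (d - 1)"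
      by (simp add: frac_le)
    moreover have "weak_prob d V c = 1 / (real d - ?s)" using True by (subst weak_prob.simps) simp
    ultimately show ?thesis by simp
  next
    case False
    then have "weak_prob d V c = 0" by (subst weak_prob.simps) auto
    then show ?thesis by simp
  qed
qed

lemma sum_weak_prob_bounds:
  assumes "d \<ge> 2"
  shows "0 \<le> (\<Sum>b<d - 1. weak_prob d V (c b)) \<and> (\<Sum>b<d - 1. weak_prob d V (c b)) \<le> 1"
  using weak_prob_bounds[OF assms] by (intro sum_le_one_of_le) auto

text \<open>After v is removed, the count ignores its children, so the average of each indicator
  times g factorizes and k becomes s. The recursion for \<open>weak_prob\<close> says (d - s) r(v) =
  1, which turns (d - 1 - s) g + h into (d - s) times the average over the mark at v.\<close>

lemma bern_sum_peel:
  assumes "finite V" "V \<subseteq> tree_verts d" "d \<ge> 2" "W \<subseteq> V"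
    and "v \<in> W" "v = u @ [a]" "v \<notin> B" "\<And>y. y \<in> W \<Longrightarrow> \<not> child v y"
  shows "bern_sum V (weak_prob d V) (\<lambda>J. card (allowed_configs d B q W J))
    = (real d - (\<Sum>b<d - 1. weak_prob d V (v @ [b])))
      * bern_sum V (weak_prob d V) (\<lambda>J. card (allowed_configs d B q (W - {v}) J))"
proof -
  define R where "R = weak_prob d V"
  define s where "s = (\<Sum>b<d - 1. R (v @ [b]))"
  define g where "g J = real (card (allowed_configs d B q (W - {v}) (J - {v})))" for J
  define h where "h J = real (card (allowed_configs d B q (W - {v}) (insert v J)))" for J
  have vV: "v \<in> V" "v \<in> tree_verts d" using assms by auto
  have ind: "bern_sum V R (\<lambda>J. of_bool (v @ [b] \<in> J) * g J) = R (v @ [b]) * bern_sum V R g" for b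
  proof (cases "v @ [b] \<in> V")
    case True
    have "g (insert (v @ [b]) J) = g J" for J
      unfolding g_def by (subst allowed_configs_cong[of _ _ "J - {v}"]) (auto simp: child_def)
    then show ?thesis using bern_sum_indicator[OF assms(1) True, of g R] by simp
  next
    \<comment> \<open>A child outside V belongs to no J within V, and its \<open>weak_prob\<close>
      is 0.\<close>
    case False
    then have "bern_sum V R (\<lambda>J. of_bool (v @ [b] \<in> J) * g J) = bern_sum V R (\<lambda>J. 0 * g J)"
      by (intro bern_sum_cong) auto
    then show ?thesis using False unfolding bern_sum_cmult by (simp add: R_def weak_prob.simps[of d V "v @ [b]"])
  qed
  have "bern_sum V R (\<lambda>J. card (allowed_configs d B q W J))
      = bern_sum V R (\<lambda>J. (real d - 1) * g J - (\<Sum>b<d - 1. of_bool (v @ [b] \<in> J) * g J) + h J)"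
  proof (rule bern_sum_cong)
    fix J assume J: "J \<subseteq> V"
    have W: "finite W" "finite J" "J \<subseteq> tree_verts d" using assms(1,2,4) J finite_subset by auto
    have "(\<Sum>b<d - 1. of_bool (v @ [b] \<in> J) * g J) = (\<Sum>b<d - 1. of_bool (v @ [b] \<in> J)) * g J"
      by (rule sum_distrib_right[symmetric])
    then show "real (card (allowed_configs d B q W J))
        = (real d - 1) * g J - (\<Sum>b<d - 1. of_bool (v @ [b] \<in> J) * g J) + h J"
      using card_allowed_configs_remove[OF W(1) assms(5,6) vV(2) assms(7,8) W(2,3), of q]
      unfolding g_def h_def by (simp only: left_diff_distrib)
  qed
  also have "\<dots> = (real d - 1 - s) * bern_sum V R g + bern_sum V R h"
    unfolding bern_sum_add bern_sum_diff bern_sum_cmult bern_sum_sum ind s_def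
    by (simp add: left_diff_distrib sum_distrib_right)
  also have "\<dots> = (real d - s) * (R v * bern_sum V R h + (1 - R v) * bern_sum V R g)"
  proof -
    have "s \<le> 1" using sum_weak_prob_bounds[OF assms(3), of V "\<lambda>b. v @ [b]"] by (simp add: s_def R_def)
    then have "real d - s > 0" using assms(3) by linarith
    moreover have "R v = 1 / (real d - s)"
      using vV assms(1) by (simp add: R_def s_def weak_prob.simps[of d V v])
    ultimately have "(real d - s) * R v = 1" by simp
    then show ?thesis by algebra
  qed
  also have "R v * bern_sum V R h + (1 - R v) * bern_sum V R g
      = bern_sum V R (\<lambda>J. card (allowed_configs d B q (W - {v}) J))"
    unfolding g_def h_def
    using bern_sum_split[OF assms(1) vV(1), of R "\<lambda>J. card (allowed_configs d B q (W - {v}) J)"] by simp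
  finally show ?thesis by (simp add: R_def s_def)
qed

text \<open>A longest vertex outside B has no child left in W: one outside B would be longer, and
  one in B would force the vertex into B. C is the product of the factors d - s; choosing it before
  q is what permits normalization later.\<close>

lemma bern_sum_peel_all:
  assumes "finite V" "V \<subseteq> tree_verts d" "d \<ge> 2" "W \<subseteq> V" "B \<subseteq> W"
    and B: "[] \<in> B" "\<forall>x b. x @ [b] \<in> B \<longrightarrow> x \<in> B"
  shows "\<exists>C>0. \<forall>q. bern_sum V (weak_prob d V) (\<lambda>J. card (allowed_configs d B q W J))
    = C * bern_sum V (weak_prob d V) (\<lambda>J. card (allowed_configs d B q B J))"
  using assms(4,5)
proof (induction "card (W - B)" arbitrary: W)
  case 0
  have "finite (W - B)" using 0 assms(1) finite_subset by blast
  then have "W = B" using 0 by auto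
  then show ?case by (intro exI[of _ 1]) simp
next
  case (Suc n)
  have fin: "finite (W - B)" using Suc.prems assms(1) finite_subset by blast
  then have "W - B \<noteq> {}" using Suc.hyps(2) by (metis card.empty nat.distinct(1))
  then have "Max (length ` (W - B)) \<in> length ` (W - B)" using fin by (intro Max_in) auto
  then obtain v where "v \<in> W - B" "length v = Max (length ` (W - B))" by auto
  with fin have v: "v \<in> W" "v \<notin> B" "\<And>y. y \<in> W - B \<Longrightarrow> length y \<le> length v" by auto
  obtain u a where ua: "v = u @ [a]" using v(2) B(1) by (metis rev_exhaust)
  have leaf: "\<not> child v y" if "y \<in> W" for y
  proof
    assume "child v y"
    then obtain b where y: "y = v @ [b]" by (auto simp: child_def)
    then have "y \<notin> B" using B(2) v(2) by blast
    then have "length y \<le> length v" using v(3) that by blast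
    then show False using y by simp
  qed
  have "W - {v} - B = W - B - {v}" by blast
  then have "n = card (W - {v} - B)" using Suc.hyps(2) v fin by simp
  moreover have "W - {v} \<subseteq> V" "B \<subseteq> W - {v}" using Suc.prems v by auto
  ultimately obtain C where C: "C > 0" "\<forall>q. bern_sum V (weak_prob d V) (\<lambda>J. card (allowed_configs d B q (W - {v}) J))
    = C * bern_sum V (weak_prob d V) (\<lambda>J. card (allowed_configs d B q B J))"
    using Suc.hyps(1) by blast
  let ?c = "real d - (\<Sum>b<d - 1. weak_prob d V (v @ [b]))"
  have "(\<Sum>b<d - 1. weak_prob d V (v @ [b])) \<le> 1" using sum_weak_prob_bounds[OF assms(3), of V "\<lambda>b. v @ [b]"] by blast
  then have "?c > 0" using assms(3) by linarith
  moreover have "\<forall>q. bern_sum V (weak_prob d V) (\<lambda>J. card (allowed_configs d B q W J))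
    = ?c * C * bern_sum V (weak_prob d V) (\<lambda>J. card (allowed_configs d B q B J))"
    using bern_sum_peel[OF assms(1,2,3) Suc.prems(1) v(1) ua v(2) leaf] C(2) by simp
  ultimately show ?case using C(1) by (intro exI[of _ "?c * C"]) simp
qed

text \<open>For B closed under parents and containing the root, these are the roots of the branches
  that make up the complement of B.\<close>

definition child_boundary :: "nat \<Rightarrow> nat list set \<Rightarrow> nat list set" where
  "child_boundary d B = {y \<in> tree_verts d - B. \<exists>x\<in>B. child x y}"

text \<open>The two ends of the peeling: for W = V no mark lies outside W, so the average is the
  plain number of recurrent configurations; for W = B the configuration is q itself, so the count is
  an indicator.\<close>

lemma card_recurrent_restrict:
  assumes "finite V" "V \<subseteq> tree_verts d" "d \<ge> 2" "B \<union> child_boundary d B \<subseteq> V"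
    and B: "[] \<in> B" "\<forall>x b. x @ [b] \<in> B \<longrightarrow> x \<in> B"
  shows "\<exists>C>0. \<forall>q\<in>stable_configs d B. card {\<eta> \<in> recurrent_configs d V. \<forall>x\<in>B. \<eta> x = q x}
    = C * bern_sum (child_boundary d B) (weak_prob d V) (\<lambda>J. of_bool (allowed B J q))"
proof -
  obtain C where C: "C > 0" "\<And>q. bern_sum V (weak_prob d V) (\<lambda>J. card (allowed_configs d B q V J))
    = C * bern_sum V (weak_prob d V) (\<lambda>J. card (allowed_configs d B q B J))"
  proof -
    have "B \<subseteq> V" using assms(4) by simp
    from bern_sum_peel_all[OF assms(1-3) order.refl this B] that show ?thesis by blast
  qed
  have "card {\<eta> \<in> recurrent_configs d V. \<forall>x\<in>B. \<eta> x = q x}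
    = C * bern_sum (child_boundary d B) (weak_prob d V) (\<lambda>J. of_bool (allowed B J q))"
    if q: "q \<in> stable_configs d B" for q
  proof -
    have "bern_sum V (weak_prob d V) (\<lambda>J. card (allowed_configs d B q V J))
        = bern_sum V (weak_prob d V) (\<lambda>J. card (allowed_configs d B q V {}))"
    proof (rule bern_sum_cong)
      fix J assume "J \<subseteq> V"
      then have "allowed_configs d B q V J = allowed_configs d B q V {}"
        by (intro allowed_configs_cong) auto
      then show "real (card (allowed_configs d B q V J)) = real (card (allowed_configs d B q V {}))" by simp
    qed
    \<comment> \<open>The summand is constant in J, and the weights have total mass 1.\<close>
    also have "\<dots> = bern_sum {} (weak_prob d V) (\<lambda>J. card (allowed_configs d B q V {}))"
      using assms(1) by (intro bern_sum_restrict) auto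
    also have "\<dots> = card (allowed_configs d B q V {})" by (simp add: bern_sum_def)
    also have "allowed_configs d B q V {} = {\<eta> \<in> recurrent_configs d V. \<forall>x\<in>B. \<eta> x = q x}"
      using recurrent_configs_eq[OF assms(1-3)] by (auto simp: allowed_configs_def)
    finally have 1: "card {\<eta> \<in> recurrent_configs d V. \<forall>x\<in>B. \<eta> x = q x}
        = bern_sum V (weak_prob d V) (\<lambda>J. card (allowed_configs d B q V J))" by simp
    have "real (card (allowed_configs d B q B J)) = of_bool (allowed B J q)" for J
    proof -
      have "\<eta> = q" if "\<eta> \<in> stable_configs d B" "\<forall>x\<in>B. \<eta> x = q x" for \<eta>
        using that q by (fastforce simp: stable_configs_def)
      then have "allowed_configs d B q B J = (if allowed B J q then {q} else {})"
        using q by (auto simp: allowed_configs_def)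
      then show ?thesis by simp
    qed
    then have "bern_sum V (weak_prob d V) (\<lambda>J. card (allowed_configs d B q B J))
        = bern_sum V (weak_prob d V) (\<lambda>J. of_bool (allowed B J q))" by simp
    also have "\<dots> = bern_sum (child_boundary d B) (weak_prob d V) (\<lambda>J. of_bool (allowed B J q))"
    proof (rule bern_sum_restrict)
      fix J assume "J \<subseteq> V"
      then have "allowed B J q \<longleftrightarrow> allowed B (J \<inter> child_boundary d B) q"
        using assms(2) by (intro allowed_cong) (auto simp: child_boundary_def)
      then show "of_bool (allowed B J q) = (of_bool (allowed B (J \<inter> child_boundary d B) q) :: real)" by simp
    qed (use assms in auto)
    finally show ?thesis using 1 C(2) by simp
  qed
  with C(1) show ?thesis by blast
qed

subsection \<open>Convergence of the marginals\<close>

lemma exhaustion_eventually: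
  assumes "exhaustion d V" "finite S" "S \<subseteq> tree_verts d"
  shows "\<forall>\<^sub>F n in sequentially. S \<subseteq> V n"
proof -
  have "\<forall>\<^sub>F n in sequentially. x \<in> V n" if x: "x \<in> S" for x
  proof -
    have "mono V" using assms(1) by (intro mono_iff_le_Suc[THEN iffD2]) (auto simp: exhaustion_def)
    obtain m where "x \<in> V m" using assms(1,3) x unfolding exhaustion_def by blast
    with \<open>mono V\<close> have "\<forall>n\<ge>m. x \<in> V n" by (meson monoD subsetD)
    then show ?thesis by (auto simp: eventually_sequentially)
  qed
  then have "\<forall>\<^sub>F n in sequentially. \<forall>x\<in>S. x \<in> V n" using assms(2) by (simp add: eventually_ball_finite)
  then show ?thesis by (rule eventually_mono) blast
qed

text \<open>At the fixed point s = 1. The deviation of 1 / (d - s) from it is (s - 1) / ((d - s) (d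
  - 1)); here |s - 1| is at most d - 1 times the error at the children and d - s is at least d - 1.
  Each level of descendants contained in V thus gains a factor 1 / (d - 1).\<close>

lemma weak_prob_error:
  assumes "d \<ge> 3" "finite V" "(\<lambda>w. c @ w) ` {w. set w \<subseteq> {..<d - 1} \<and> length w < k} \<subseteq> V"
  shows "\<bar>weak_prob d V c - 1 / real (d - 1)\<bar> \<le> (1 / 2) ^ k"
  using assms(3)
proof (induction k arbitrary: c)
  case 0
  have "0 \<le> weak_prob d V c" "weak_prob d V c \<le> 1 / real (d - 1)"
    using weak_prob_bounds[of d V c] assms(1) by auto
  moreover have "1 / real (d - 1) \<le> 1" using assms(1) by simp
  moreover have "\<bar>x - y\<bar> \<le> 1" if "0 \<le> x" "x \<le> y" "y \<le> 1" for x y :: real using that by linarith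
  ultimately show ?case by simp
next
  case (Suc k)
  define D where "D = real (d - 1)"
  have D: "D \<ge> 2" "real d = D + 1" using assms(1) by (auto simp: D_def of_nat_diff)
  define e :: real where "e = (1 / 2) ^ k"
  have e: "e \<ge> 0" by (simp add: e_def)
  define s where "s = (\<Sum>b<d - 1. weak_prob d V (c @ [b]))"
  have "c @ [] \<in> (\<lambda>w. c @ w) ` {w. set w \<subseteq> {..<d - 1} \<and> length w < Suc k}" by (rule imageI) simp
  with Suc.prems have c: "c \<in> V" by auto
  have "\<bar>weak_prob d V (c @ [b]) - 1 / D\<bar> \<le> e" if b: "b < d - 1" for b
    unfolding D_def e_def
  proof (rule Suc.IH, rule image_subsetI)
    fix w assume "w \<in> {w. set w \<subseteq> {..<d - 1} \<and> length w < k}"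
    then have "b # w \<in> {w. set w \<subseteq> {..<d - 1} \<and> length w < Suc k}" using b by simp
    then have "c @ (b # w) \<in> V" using Suc.prems by blast
    then show "(c @ [b]) @ w \<in> V" by simp
  qed
  then have "(\<Sum>b<d - 1. \<bar>weak_prob d V (c @ [b]) - 1 / D\<bar>) \<le> (\<Sum>b<d - 1. e)"
    by (intro sum_mono) simp
  then have "\<bar>\<Sum>b<d - 1. weak_prob d V (c @ [b]) - 1 / D\<bar> \<le> D * e"
    by (intro order_trans[OF sum_abs]) (simp add: D_def)
  moreover have "(\<Sum>b<d - 1. weak_prob d V (c @ [b]) - 1 / D) = s - 1"
    using D by (simp add: sum_subtractf s_def D_def)
  ultimately have s1: "\<bar>s - 1\<bar> \<le> D * e" by simp
  have "s \<le> 1" using sum_weak_prob_bounds[of d V "\<lambda>b. c @ [b]"] assms(1) by (simp add: s_def)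
  then have ds: "D \<le> real d - s" using D by simp
  have "weak_prob d V c = 1 / (real d - s)" using c assms(2) unfolding s_def by (subst weak_prob.simps) simp
  then have "weak_prob d V c - 1 / D = (s - 1) / ((real d - s) * D)"
  proof -
    have "1 / E - 1 / D = (D - E) / (E * D)" if "E > 0" for E using that D(1) by (simp add: field_simps)
    from this[of "real d - s"] show ?thesis using D ds \<open>weak_prob d V c = _\<close> by simp
  qed
  then have "\<bar>weak_prob d V c - 1 / D\<bar> = \<bar>s - 1\<bar> / ((real d - s) * D)"
    using D ds by (simp add: abs_mult)
  also have "\<dots> \<le> (D * e) / (D * D)"
    using s1 D ds e by (intro frac_le mult_right_mono mult_pos_pos) auto
  also have "\<dots> = e / D" using D by simp
  \<comment> \<open>Here d \<ge> 3 enters: it gives D \<ge> 2 and makes the recursion a strict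
    contraction.\<close>
  also have "\<dots> \<le> e / 2" using D e by (intro divide_left_mono) auto
  finally show ?case by (simp add: e_def D_def)
qed

lemma append_tree_verts:
  assumes "c \<in> tree_verts d" "c \<noteq> []" "set w \<subseteq> {..<d - 1}"
  shows "c @ w \<in> tree_verts d"
  using assms(3)
proof (induction w rule: rev_induct)
  case (snoc b w)
  then show ?case using snoc_in_tree_verts[of "c @ w" b d] assms(2) by simp
qed (use assms in simp)

text \<open>A given precision involves only finitely many levels below c, which every exhaustion
  eventually contains; hence the limit forgets the exhaustion.\<close>

lemma weak_prob_tendsto:
  assumes "d \<ge> 3" "exhaustion d V" "c \<in> tree_verts d" "c \<noteq> []"
  shows "(\<lambda>n. weak_prob d (V n) c) \<longlonglongrightarrow> 1 / real (d - 1)"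
proof (rule LIMSEQ_I)
  fix r :: real assume "r > 0"
  then obtain k where k: "(1 / 2 :: real) ^ k < r" using real_arch_pow_inv[of r "1 / 2"] by auto
  let ?S = "(\<lambda>w. c @ w) ` {w. set w \<subseteq> {..<d - 1} \<and> length w < k}"
  have "finite {w. set w \<subseteq> {..<d - 1} \<and> length w \<le> k}" by (rule finite_lists_length_le) simp
  then have "finite ?S" by (intro finite_imageI) (rule finite_subset[rotated], auto)
  moreover have "?S \<subseteq> tree_verts d" using append_tree_verts[OF assms(3,4)] by blast
  ultimately have "\<forall>\<^sub>F n in sequentially. ?S \<subseteq> V n" by (rule exhaustion_eventually[OF assms(2)])
  then have "\<forall>\<^sub>F n in sequentially. norm (weak_prob d (V n) c - 1 / real (d - 1)) < r"
  proof (rule eventually_mono)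
    fix n assume "?S \<subseteq> V n"
    moreover have "finite (V n)" using assms(2) by (simp add: exhaustion_def)
    ultimately show "norm (weak_prob d (V n) c - 1 / real (d - 1)) < r"
      using weak_prob_error[OF assms(1), of "V n" c k] k by simp
  qed
  then show "\<exists>N. \<forall>n\<ge>N. norm (weak_prob d (V n) c - 1 / real (d - 1)) < r"
    by (simp add: eventually_sequentially)
qed

section \<open>Marginals on balls and their limits\<close>

definition tree_ball :: "nat \<Rightarrow> nat \<Rightarrow> nat list set" where
  "tree_ball d m = {x \<in> tree_verts d. length x \<le> m}"

lemma finite_tree_ball: "finite (tree_ball d m)"
proof -
  have "set x \<subseteq> {..<d}" if "x \<in> tree_verts d" for x
  proof
    fix a assume "a \<in> set x"
    then obtain i where "i < length x" "x ! i = a" by (metis in_set_conv_nth)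
    with that show "a \<in> {..<d}" by (fastforce simp: tree_verts_def split: if_splits)
  qed
  then have "tree_ball d m \<subseteq> {x. set x \<subseteq> {..<d} \<and> length x \<le> m}" by (auto simp: tree_ball_def)
  then show ?thesis using finite_lists_length_le[of "{..<d}" m] finite_subset by blast
qed

text \<open>A concrete exhaustion, along which the limits inherit positivity, normalization and
  consistency from the finite marginals.\<close>

lemma exhaustion_tree_ball: "exhaustion d (tree_ball d)"
  unfolding exhaustion_def using finite_tree_ball by (auto simp: tree_ball_def)

lemma child_boundary_tree_ball: "child_boundary d (tree_ball d m) \<subseteq> tree_ball d (Suc m)"
  by (auto simp: child_boundary_def tree_ball_def child_def)

lemma finite_recurrent_configs:
  assumes "finite V"
  shows "finite (recurrent_configs d V)"
  using finite_stable_configs[OF assms] by (rule finite_subset[rotated]) (auto simp: recurrent_configs_def)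

lemma max_config_stable: "d > 0 \<Longrightarrow> max_config d V \<in> stable_configs d V"
  by (simp add: max_config_def stable_configs_def)

lemma card_recurrent_pos:
  assumes "finite V" "V \<subseteq> tree_verts d" "d \<ge> 2"
  shows "card (recurrent_configs d V) > 0"
proof -
  have "max_config d V \<in> recurrent_configs d V"
    using assms recurrent_configs_eq[OF assms] max_config_stable allowed_max_config by simp
  then show ?thesis using finite_recurrent_configs[OF assms(1)] card_gt_0_iff by blast
qed

text \<open>Recurrent configurations are grouped by their restriction to K, which is encoded with
  value 0 outside K so that it lies in \<open>stable_configs d K\<close>.\<close>

lemma sandpile_marginal_sum:
  assumes "finite V" "A \<subseteq> K" "K \<subseteq> V"
  shows "sandpile_marginal d V A p
    = (\<Sum>q\<in>{q \<in> stable_configs d K. \<forall>x\<in>A. q x = p x}. sandpile_marginal d V K q)"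
proof -
  let ?S = "{\<eta> \<in> recurrent_configs d V. \<forall>x\<in>A. \<eta> x = p x}"
  let ?T = "{q \<in> stable_configs d K. \<forall>x\<in>A. q x = p x}"
  let ?g = "\<lambda>\<eta> y. if y \<in> K then \<eta> y else (0::nat)"
  have finS: "finite ?S" using finite_recurrent_configs[OF assms(1)] by simp
  have finT: "finite ?T" using finite_stable_configs[OF finite_subset[OF assms(3,1)]] by simp
  have im: "?g ` ?S \<subseteq> ?T"
    using assms(2,3) by (auto simp: recurrent_configs_def stable_configs_def)
  have fib: "{\<eta> \<in> ?S. ?g \<eta> = q} = {\<eta> \<in> recurrent_configs d V. \<forall>x\<in>K. \<eta> x = q x}" if q: "q \<in> ?T" for q
  proof -
    have "?g \<eta> = q \<longleftrightarrow> (\<forall>x\<in>K. \<eta> x = q x)" for \<eta>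
    proof
      assume H: "\<forall>x\<in>K. \<eta> x = q x"
      show "?g \<eta> = q"
      proof
        fix y show "?g \<eta> y = q y" using H q by (simp add: stable_configs_def)
      qed
    next
      assume "?g \<eta> = q"
      then show "\<forall>x\<in>K. \<eta> x = q x" by auto
    qed
    moreover have "\<forall>x\<in>A. \<eta> x = p x" if "\<forall>x\<in>K. \<eta> x = q x" for \<eta>
      using that q assms(2) by auto
    ultimately show ?thesis by blast
  qed
  have "real (card ?S) = (\<Sum>q\<in>?T. \<Sum>\<eta>\<in>{\<eta> \<in> ?S. ?g \<eta> = q}. 1)"
    unfolding sum.group[OF finS finT im] by simp
  also have "\<dots> = (\<Sum>q\<in>?T. real (card {\<eta> \<in> recurrent_configs d V. \<forall>x\<in>K. \<eta> x = q x}))"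
    by (intro sum.cong refl) (simp only: fib sum_constant mult_1_right)
  finally show ?thesis by (simp add: sandpile_marginal_def sum_divide_distrib)
qed

lemma sandpile_marginal_empty:
  assumes "finite V" "V \<subseteq> tree_verts d" "d \<ge> 2"
  shows "sandpile_marginal d V {} p = 1"
  using card_recurrent_pos[OF assms] by (simp add: sandpile_marginal_def)

text \<open>The unnormalized weight of q when the boundary vertices are independently weak with
  probabilities \<rho>. With \<rho> as a parameter, the same finite expression serves for each V and
  for the limit.\<close>

definition ball_weight :: "nat \<Rightarrow> nat \<Rightarrow> (nat list \<Rightarrow> real) \<Rightarrow> (nat list \<Rightarrow> nat) \<Rightarrow> real" where
  "ball_weight d m \<rho> q = bern_sum (child_boundary d (tree_ball d m)) \<rho> (\<lambda>J. of_bool (allowed (tree_ball d m) J q))"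

text \<open>The unknown constant C is eliminated because the marginals on the ball sum to 1.\<close>

lemma sandpile_marginal_tree_ball:
  assumes "finite V" "V \<subseteq> tree_verts d" "d \<ge> 2" "tree_ball d (Suc m) \<subseteq> V"
    and "q \<in> stable_configs d (tree_ball d m)"
  shows "sandpile_marginal d V (tree_ball d m) q
    = ball_weight d m (weak_prob d V) q / (\<Sum>q\<in>stable_configs d (tree_ball d m). ball_weight d m (weak_prob d V) q)"
proof -
  let ?B = "tree_ball d m"
  have BV: "?B \<subseteq> V" using assms(4) by (auto simp: tree_ball_def)
  have sub: "?B \<union> child_boundary d ?B \<subseteq> V" using BV child_boundary_tree_ball assms(4) by blast
  have "[] \<in> ?B" "\<forall>x b. x @ [b] \<in> ?B \<longrightarrow> x \<in> ?B"
    by (auto simp: tree_ball_def snoc_in_tree_verts)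
  then obtain C where C: "C > 0" "\<And>q. q \<in> stable_configs d ?B \<Longrightarrow>
      card {\<eta> \<in> recurrent_configs d V. \<forall>x\<in>?B. \<eta> x = q x} = C * ball_weight d m (weak_prob d V) q"
    using card_recurrent_restrict[OF assms(1-3) sub] unfolding ball_weight_def by blast
  define N where "N = real (card (recurrent_configs d V))"
  have N: "N > 0" using card_recurrent_pos[OF assms(1-3)] by (simp add: N_def)
  have marg: "sandpile_marginal d V ?B q = C * ball_weight d m (weak_prob d V) q / N"
    if "q \<in> stable_configs d ?B" for q
    using C(2)[OF that] by (simp add: sandpile_marginal_def N_def)
  have "1 = (\<Sum>q\<in>stable_configs d ?B. sandpile_marginal d V ?B q)"
    using sandpile_marginal_sum[OF assms(1) _ BV, of "{}"] sandpile_marginal_empty[OF assms(1-3)] by simp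
  also have "\<dots> = C * (\<Sum>q\<in>stable_configs d ?B. ball_weight d m (weak_prob d V) q) / N"
    using marg by (simp add: sum_distrib_left sum_divide_distrib)
  finally have "N = C * (\<Sum>q\<in>stable_configs d ?B. ball_weight d m (weak_prob d V) q)"
    using N by (simp add: field_simps)
  then show ?thesis using marg[OF assms(5)] C(1) by simp
qed

text \<open>Marginals are finite sums of quotients continuous in the boundary probabilities. The
  denominator stays positive in the limit: \<open>max_config\<close> is allowed without marks, and J
  = {} has positive weight as 1 / (d - 1) < 1.\<close>

lemma sandpile_marginal_convergent:
  assumes "d \<ge> 3" "finite A" "A \<subseteq> tree_verts d"
  shows "\<exists>l. \<forall>V. exhaustion d V \<longrightarrow> (\<lambda>n. sandpile_marginal d (V n) A p) \<longlonglongrightarrow> l"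
proof -
  define m where "m = Max (length ` A)"
  define \<rho> :: "nat list \<Rightarrow> real" where "\<rho> = (\<lambda>_. 1 / real (d - 1))"
  let ?B = "tree_ball d m"
  let ?S = "stable_configs d ?B"
  \<comment> \<open>For A = {} the value of \<open>Max\<close> is unspecified, but the inclusion is
    then trivial.\<close>
  have AB: "A \<subseteq> ?B" using assms(2,3) by (auto simp: tree_ball_def m_def)
  have finbd: "finite (child_boundary d ?B)"
    using child_boundary_tree_ball finite_tree_ball finite_subset by blast
  have \<rho>: "0 \<le> \<rho> c \<and> \<rho> c < 1" for c using assms(1) by (simp add: \<rho>_def)
  have nonneg: "0 \<le> ball_weight d m \<rho> q" for q
    unfolding ball_weight_def using \<rho> by (intro bern_sum_nonneg) (auto simp: less_imp_le)
  have mx: "max_config d ?B \<in> ?S" using assms(1) by (intro max_config_stable) simp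
  have "0 < ball_weight d m \<rho> (max_config d ?B)"
    unfolding ball_weight_def using \<rho> finbd allowed_max_config[OF finite_tree_ball, of d d m] assms(1)
    by (intro bern_sum_pos) auto
  then have pos: "0 < (\<Sum>q\<in>?S. ball_weight d m \<rho> q)"
    using finite_stable_configs[OF finite_tree_ball] nonneg mx
    by (intro sum_pos2[of _ "max_config d ?B"]) auto
  let ?l = "\<Sum>q\<in>{q \<in> ?S. \<forall>x\<in>A. q x = p x}. ball_weight d m \<rho> q / (\<Sum>q\<in>?S. ball_weight d m \<rho> q)"
  have "(\<lambda>n. sandpile_marginal d (V n) A p) \<longlonglongrightarrow> ?l" if V: "exhaustion d V" for V
  proof -
    have wt: "(\<lambda>n. ball_weight d m (weak_prob d (V n)) q) \<longlonglongrightarrow> ball_weight d m \<rho> q" for q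
      unfolding ball_weight_def
    proof (rule tendsto_bern_sum)
      fix c assume "c \<in> child_boundary d ?B"
      then have "c \<in> tree_verts d" "c \<noteq> []" by (auto simp: child_boundary_def child_def)
      then show "(\<lambda>n. weak_prob d (V n) c) \<longlonglongrightarrow> \<rho> c"
        unfolding \<rho>_def by (rule weak_prob_tendsto[OF assms(1) V])
    qed
    have "(\<lambda>n. \<Sum>q\<in>{q \<in> ?S. \<forall>x\<in>A. q x = p x}. ball_weight d m (weak_prob d (V n)) q
        / (\<Sum>q\<in>?S. ball_weight d m (weak_prob d (V n)) q)) \<longlonglongrightarrow> ?l"
      using pos by (intro tendsto_sum tendsto_divide wt) simp
    moreover have "tree_ball d (Suc m) \<subseteq> tree_verts d" by (auto simp: tree_ball_def)
    then have "\<forall>\<^sub>F n in sequentially. tree_ball d (Suc m) \<subseteq> V n"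
      by (rule exhaustion_eventually[OF V finite_tree_ball])
    then have "\<forall>\<^sub>F n in sequentially. (\<Sum>q\<in>{q \<in> ?S. \<forall>x\<in>A. q x = p x}. ball_weight d m (weak_prob d (V n)) q
        / (\<Sum>q\<in>?S. ball_weight d m (weak_prob d (V n)) q)) = sandpile_marginal d (V n) A p"
    proof (rule eventually_mono)
      fix n assume n: "tree_ball d (Suc m) \<subseteq> V n"
      then have BV: "?B \<subseteq> V n" by (auto simp: tree_ball_def)
      have Vn: "finite (V n)" "V n \<subseteq> tree_verts d" "d \<ge> 2" using V assms(1) by (auto simp: exhaustion_def)
      show "(\<Sum>q\<in>{q \<in> ?S. \<forall>x\<in>A. q x = p x}. ball_weight d m (weak_prob d (V n)) q
        / (\<Sum>q\<in>?S. ball_weight d m (weak_prob d (V n)) q)) = sandpile_marginal d (V n) A p"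
        unfolding sandpile_marginal_sum[OF Vn(1) AB BV]
        using sandpile_marginal_tree_ball[OF Vn n] by (intro sum.cong) auto
    qed
    ultimately show ?thesis by (rule Lim_transform_eventually)
  qed
  then show ?thesis by blast
qed

text \<open>The quantifier over V stands inside the choice, so one number serves all
  exhaustions.\<close>

definition limit_marginal :: "nat \<Rightarrow> nat list set \<Rightarrow> (nat list \<Rightarrow> nat) \<Rightarrow> real" where
  "limit_marginal d A p =
     (SOME l. \<forall>V. exhaustion d V \<longrightarrow> (\<lambda>n. sandpile_marginal d (V n) A p) \<longlonglongrightarrow> l)"

lemma limit_marginal:
  assumes "d \<ge> 3" "finite A" "A \<subseteq> tree_verts d" "exhaustion d V"
  shows "(\<lambda>n. sandpile_marginal d (V n) A p) \<longlonglongrightarrow> limit_marginal d A p"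
  using someI_ex[OF sandpile_marginal_convergent[OF assms(1-3)], of p] assms(4)
  unfolding limit_marginal_def by blast

lemma limit_marginal_nonneg:
  assumes "d \<ge> 3" "finite A" "A \<subseteq> tree_verts d"
  shows "0 \<le> limit_marginal d A p"
  using limit_marginal[OF assms exhaustion_tree_ball]
  by (rule LIMSEQ_le_const) (simp add: sandpile_marginal_def)

lemma limit_marginal_empty:
  assumes "d \<ge> 3"
  shows "limit_marginal d {} p = 1"
proof (rule LIMSEQ_unique)
  show "(\<lambda>n. sandpile_marginal d (tree_ball d n) {} p) \<longlonglongrightarrow> limit_marginal d {} p"
    by (rule limit_marginal[OF assms _ _ exhaustion_tree_ball]) auto
  have "sandpile_marginal d (tree_ball d n) {} p = 1" for n
    using assms finite_tree_ball by (intro sandpile_marginal_empty) (auto simp: tree_ball_def)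
  then show "(\<lambda>n. sandpile_marginal d (tree_ball d n) {} p) \<longlonglongrightarrow> 1" by simp
qed

text \<open>Kolmogorov consistency: the identity for finite graphs passes to the limit because the
  sum is finite.\<close>

lemma limit_marginal_sum:
  assumes "d \<ge> 3" "finite K" "K \<subseteq> tree_verts d" "A \<subseteq> K"
  shows "limit_marginal d A p
    = (\<Sum>q\<in>{q \<in> stable_configs d K. \<forall>x\<in>A. q x = p x}. limit_marginal d K q)"
proof (rule LIMSEQ_unique)
  show "(\<lambda>n. sandpile_marginal d (tree_ball d n) A p) \<longlonglongrightarrow> limit_marginal d A p"
    using assms finite_subset by (intro limit_marginal[OF assms(1) _ _ exhaustion_tree_ball]) auto
  have "(\<lambda>n. \<Sum>q\<in>{q \<in> stable_configs d K. \<forall>x\<in>A. q x = p x}. sandpile_marginal d (tree_ball d n) K q)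
     \<longlonglongrightarrow> (\<Sum>q\<in>{q \<in> stable_configs d K. \<forall>x\<in>A. q x = p x}. limit_marginal d K q)"
    by (intro tendsto_sum limit_marginal[OF assms(1-3) exhaustion_tree_ball])
  moreover have "\<forall>\<^sub>F n in sequentially. K \<subseteq> tree_ball d n"
    by (rule exhaustion_eventually[OF exhaustion_tree_ball assms(2,3)])
  then have "\<forall>\<^sub>F n in sequentially.
      (\<Sum>q\<in>{q \<in> stable_configs d K. \<forall>x\<in>A. q x = p x}. sandpile_marginal d (tree_ball d n) K q)
      = sandpile_marginal d (tree_ball d n) A p"
    by (rule eventually_mono) (rule sandpile_marginal_sum[OF finite_tree_ball assms(4), symmetric])
  ultimately show "(\<lambda>n. sandpile_marginal d (tree_ball d n) A p)
     \<longlonglongrightarrow> (\<Sum>q\<in>{q \<in> stable_configs d K. \<forall>x\<in>A. q x = p x}. limit_marginal d K q)"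
    by (rule Lim_transform_eventually)
qed

subsection \<open>The limit measure\<close>

text \<open>Outside K the value is \<open>undefined\<close>, not 0, since points of a product space
  are extensional functions.\<close>

definition real_config :: "nat list set \<Rightarrow> (nat list \<Rightarrow> nat) \<Rightarrow> nat list \<Rightarrow> real" where
  "real_config K q = (\<lambda>x\<in>K. real (q x))"

text \<open>Real-valued because the library states Kolmogorov's extension theorem for Borel
  measures on Polish spaces.\<close>

definition fidi :: "nat \<Rightarrow> nat list set \<Rightarrow> (nat list \<Rightarrow> real) measure" where
  "fidi d K = distr (point_measure (stable_configs d K) (\<lambda>q. ennreal (limit_marginal d K q)))
     (PiM K (\<lambda>_. borel)) (real_config K)"

lemma sets_fidi [simp]: "sets (fidi d K) = sets (PiM K (\<lambda>_. borel))"
  by (simp add: fidi_def)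

lemma space_fidi [simp]: "space (fidi d K) = space (PiM K (\<lambda>_. borel))"
  by (simp add: fidi_def)

lemma real_config_space: "real_config K q \<in> space (PiM K (\<lambda>_. borel))"
  by (simp add: real_config_def space_PiM)

lemma emeasure_fidi:
  assumes "finite K" "X \<in> sets (PiM K (\<lambda>_. borel))"
  shows "emeasure (fidi d K) X
    = (\<Sum>q\<in>{q \<in> stable_configs d K. real_config K q \<in> X}. ennreal (limit_marginal d K q))"
proof -
  let ?M = "point_measure (stable_configs d K) (\<lambda>q. ennreal (limit_marginal d K q))"
  have "real_config K \<in> measurable ?M (PiM K (\<lambda>_. borel))"
    unfolding measurable_point_measure_eq1 using real_config_space by blast
  then have "emeasure (fidi d K) X = emeasure ?M (real_config K -` X \<inter> space ?M)"
    unfolding fidi_def using assms(2) by (rule emeasure_distr)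
  also have "real_config K -` X \<inter> space ?M = {q \<in> stable_configs d K. real_config K q \<in> X}"
    by (auto simp: space_point_measure)
  finally show ?thesis
    using finite_stable_configs[OF assms(1)] by (simp add: emeasure_point_measure_finite)
qed

lemma prob_space_fidi:
  assumes "d \<ge> 3" "finite K" "K \<subseteq> tree_verts d"
  shows "prob_space (fidi d K)"
proof
  have "{q \<in> stable_configs d K. real_config K q \<in> space (PiM K (\<lambda>_. borel))} = stable_configs d K"
    using real_config_space by blast
  then have "emeasure (fidi d K) (space (fidi d K)) = (\<Sum>q\<in>stable_configs d K. ennreal (limit_marginal d K q))"
    using emeasure_fidi[OF assms(2) sets.top, of d] by simp
  also have "\<dots> = ennreal (\<Sum>q\<in>stable_configs d K. limit_marginal d K q)"
    using limit_marginal_nonneg[OF assms] by (intro sum_ennreal) auto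
  also have "(\<Sum>q\<in>stable_configs d K. limit_marginal d K q) = 1"
    using limit_marginal_sum[OF assms, of "{}"] limit_marginal_empty[OF assms(1)] by simp
  finally show "emeasure (fidi d K) (space (fidi d K)) = 1" by simp
qed

text \<open>Both sides are finite sums over atoms. Grouping those on H by their restriction to K
  reduces the claim to \<open>limit_marginal_sum\<close>.\<close>

lemma fidi_projective:
  assumes "d \<ge> 3" "K \<subseteq> H" "finite H" "H \<subseteq> tree_verts d"
  shows "fidi d K = distr (fidi d H) (PiM K (\<lambda>_. borel)) (\<lambda>f. restrict f K)"
proof (rule measure_eqI)
  fix X assume "X \<in> sets (fidi d K)"
  then have X: "X \<in> sets (PiM K (\<lambda>_. borel))" by simp
  have K: "finite K" "K \<subseteq> tree_verts d" using assms finite_subset by auto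
  let ?g = "\<lambda>\<eta> y. if y \<in> K then \<eta> y else (0::nat)"
  let ?S = "{q \<in> stable_configs d H. real_config K q \<in> X}"
  let ?T = "{q \<in> stable_configs d K. real_config K q \<in> X}"
  have finS: "finite ?S" "finite ?T" using finite_stable_configs assms(3) K by auto
  have cong: "real_config K q = real_config K q'" if "\<forall>x\<in>K. q x = q' x" for q q'
    unfolding real_config_def using that by (intro restrict_ext) simp
  have "real_config K (?g q) = real_config K q" for q by (rule cong) simp
  then have im: "?g ` ?S \<subseteq> ?T"
    using assms(2) by (auto simp: stable_configs_def)
  have fib: "{q \<in> ?S. ?g q = q'} = {q \<in> stable_configs d H. \<forall>x\<in>K. q x = q' x}" if q': "q' \<in> ?T" for q'
  proof -
    have "?g q = q' \<longleftrightarrow> (\<forall>x\<in>K. q x = q' x)" for q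
    proof
      assume H: "\<forall>x\<in>K. q x = q' x"
      show "?g q = q'"
      proof
        fix y show "?g q y = q' y" using H q' by (simp add: stable_configs_def)
      qed
    next
      assume "?g q = q'"
      then show "\<forall>x\<in>K. q x = q' x" by auto
    qed
    moreover have "real_config K q \<in> X" if "\<forall>x\<in>K. q x = q' x" for q
      using cong[OF that] q' by simp
    ultimately show ?thesis by blast
  qed
  have meas: "(\<lambda>f. restrict f K) \<in> measurable (fidi d H) (PiM K (\<lambda>_. borel))"
    using measurable_restrict_subset[OF assms(2), of "\<lambda>_. borel"] measurable_cong_sets[OF sets_fidi refl] by blast
  have pre: "(\<lambda>f. restrict f K) -` X \<inter> space (fidi d H) \<in> sets (PiM H (\<lambda>_. borel))"
    using measurable_sets[OF meas X] by simp
  have "restrict (real_config H q) K = real_config K q" for q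
    using assms(2) unfolding real_config_def by (simp add: Int_absorb1)
  then have "{q \<in> stable_configs d H. real_config H q \<in> (\<lambda>f. restrict f K) -` X \<inter> space (fidi d H)} = ?S"
    using real_config_space by auto
  then have "emeasure (distr (fidi d H) (PiM K (\<lambda>_. borel)) (\<lambda>f. restrict f K)) X
      = (\<Sum>q\<in>?S. ennreal (limit_marginal d H q))"
    using emeasure_distr[OF meas X] emeasure_fidi[OF assms(3) pre, of d] by simp
  also have "\<dots> = (\<Sum>q'\<in>?T. \<Sum>q\<in>{q \<in> ?S. ?g q = q'}. ennreal (limit_marginal d H q))"
    by (rule sum.group[OF finS im, symmetric])
  also have "\<dots> = (\<Sum>q'\<in>?T. ennreal (limit_marginal d K q'))"
  proof (rule sum.cong[OF refl])
    fix q' assume "q' \<in> ?T"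
    have "(\<Sum>q\<in>{q \<in> stable_configs d H. \<forall>x\<in>K. q x = q' x}. ennreal (limit_marginal d H q))
        = ennreal (limit_marginal d K q')"
      unfolding limit_marginal_sum[OF assms(1,3,4,2)]
      using limit_marginal_nonneg[OF assms(1,3,4)] by (intro sum_ennreal) auto
    then show "(\<Sum>q\<in>{q \<in> ?S. ?g q = q'}. ennreal (limit_marginal d H q)) = ennreal (limit_marginal d K q')"
      unfolding fib[OF \<open>q' \<in> ?T\<close>] .
  qed
  also have "\<dots> = emeasure (fidi d K) X" by (rule emeasure_fidi[OF K(1) X, symmetric])
  finally show "emeasure (fidi d K) X = emeasure (distr (fidi d H) (PiM K (\<lambda>_. borel)) (\<lambda>f. restrict f K)) X" ..
qed simp

text \<open>A measurable left inverse of the embedding of {..<d} into the reals. Reduction modulo d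
  keeps every value below d, so it maps all of the real line into the finite alphabet.\<close>

definition clip :: "nat \<Rightarrow> real \<Rightarrow> nat" where
  "clip d r = nat \<lfloor>r\<rfloor> mod d"

lemma measurable_clip: "d > 0 \<Longrightarrow> clip d \<in> measurable borel (count_space {..<d})"
  unfolding clip_def[abs_def]
  by (rule measurable_compose[OF measurable_real_floor]) simp

lemma cylinder_measurable:
  assumes "finite A" "A \<subseteq> tree_verts d"
  shows "{\<omega> \<in> space (config_space d). \<forall>x\<in>A. \<omega> x = p x} \<in> sets (config_space d)"
proof (rule sets.sets_Collect_finite_All[OF _ assms(1)])
  fix x assume "x \<in> A"
  then have "x \<in> tree_verts d" using assms(2) by blast
  then have "(\<lambda>\<omega>. \<omega> x) \<in> measurable (config_space d) (count_space {..<d})"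
    unfolding config_space_def by (rule measurable_component_singleton)
  \<comment> \<open>The intersection with {..<d} accounts for p x \<ge> d, where {p x} is not an
    event of the count space.\<close>
  then have "(\<lambda>\<omega>. \<omega> x) -` ({p x} \<inter> {..<d}) \<inter> space (config_space d) \<in> sets (config_space d)"
    by (rule measurable_sets) simp
  moreover have "(\<lambda>\<omega>. \<omega> x) -` ({p x} \<inter> {..<d}) \<inter> space (config_space d)
      = {\<omega> \<in> space (config_space d). \<omega> x = p x}"
    using \<open>x \<in> tree_verts d\<close> by (auto simp: config_space_def space_PiM)
  ultimately show "{\<omega> \<in> space (config_space d). \<omega> x = p x} \<in> sets (config_space d)" by simp
qed

text \<open>The measure is the image of the Kolmogorov limit under coordinatewise
  \<open>clip\<close>. A cylinder over A pulls back to a cylinder of the real product, whose mass is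
  read off from the atoms of \<open>fidi d A\<close>.\<close>

lemma limit_measure_exists:
  assumes "d \<ge> 3"
  shows "\<exists>\<nu>. prob_space \<nu> \<and> sets \<nu> = sets (config_space d) \<and>
    (\<forall>A p. finite A \<longrightarrow> A \<subseteq> tree_verts d \<longrightarrow>
      measure \<nu> {\<omega> \<in> space \<nu>. \<forall>x\<in>A. \<omega> x = p x} = limit_marginal d A p)"
proof -
  interpret L: polish_projective "tree_verts d" "fidi d"
  proof (intro polish_projective.intro projective_family.intro)
    show "fidi d J = distr (fidi d H) (PiM J (\<lambda>_. borel)) (\<lambda>f. restrict f J)"
      if "J \<subseteq> H" "finite H" "H \<subseteq> tree_verts d" for J H
      by (rule fidi_projective[OF assms that])
    show "prob_space (fidi d J)" if "finite J" "J \<subseteq> tree_verts d" for J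
      by (rule prob_space_fidi[OF assms that])
  qed
  let ?h = "\<lambda>\<omega>. \<lambda>x\<in>tree_verts d. clip d (\<omega> x)"
  have d: "d > 0" using assms by simp
  have h: "?h \<in> measurable L.lim (config_space d)"
    unfolding config_space_def
  proof (rule measurable_restrict)
    fix x assume x: "x \<in> tree_verts d"
    have "(\<lambda>\<omega>. \<omega> x) \<in> measurable (PiM (tree_verts d) (\<lambda>_. borel)) (borel :: real measure)"
      by (rule measurable_component_singleton[OF x])
    then have "(\<lambda>\<omega>. \<omega> x) \<in> measurable L.lim (borel :: real measure)"
      using measurable_cong_sets[OF L.sets_lim refl] by blast
    then show "(\<lambda>\<omega>. clip d (\<omega> x)) \<in> measurable L.lim (count_space {..<d})"
      by (rule measurable_compose[OF _ measurable_clip[OF d]])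
  qed
  define \<nu> where "\<nu> = distr L.lim (config_space d) ?h"
  have "prob_space \<nu>" unfolding \<nu>_def using h by (rule L.P.prob_space_distr)
  moreover have "sets \<nu> = sets (config_space d)" by (simp add: \<nu>_def)
  moreover have "measure \<nu> {\<omega> \<in> space \<nu>. \<forall>x\<in>A. \<omega> x = p x} = limit_marginal d A p"
    if A: "finite A" "A \<subseteq> tree_verts d" for A p
  proof -
    define X where "X = (\<Pi>\<^sub>E x\<in>A. clip d -` {p x})"
    have "clip d -` {p x} \<in> sets borel" for x
    proof -
      have "clip d -` ({p x} \<inter> {..<d}) \<inter> space borel \<in> sets borel"
        by (rule measurable_sets[OF measurable_clip[OF d]]) simp
      moreover have "clip d r < d" for r using d by (simp add: clip_def)
      then have "clip d -` ({p x} \<inter> {..<d}) \<inter> space borel = clip d -` {p x}" by auto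
      ultimately show ?thesis by simp
    qed
    then have X: "X \<in> sets (PiM A (\<lambda>_. borel))"
      unfolding X_def using A(1) by (intro sets_PiM_I_finite) auto
    have "measure \<nu> {\<omega> \<in> space \<nu>. \<forall>x\<in>A. \<omega> x = p x}
        = measure L.lim (?h -` {\<omega> \<in> space (config_space d). \<forall>x\<in>A. \<omega> x = p x} \<inter> space L.lim)"
      unfolding \<nu>_def space_distr by (rule measure_distr[OF h cylinder_measurable[OF A]])
    also have "?h -` {\<omega> \<in> space (config_space d). \<forall>x\<in>A. \<omega> x = p x} \<inter> space L.lim
        = prod_emb (tree_verts d) (\<lambda>_. borel) A X"
    proof (intro set_eqI)
      fix \<omega> :: "nat list \<Rightarrow> real"
      have "?h \<omega> \<in> space (config_space d)"
        using d by (auto simp: config_space_def space_PiM clip_def)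
      moreover have "(\<forall>x\<in>A. ?h \<omega> x = p x) \<longleftrightarrow> restrict \<omega> A \<in> X"
        using A(2) by (auto simp: X_def PiE_iff)
      ultimately show "\<omega> \<in> ?h -` {\<omega> \<in> space (config_space d). \<forall>x\<in>A. \<omega> x = p x} \<inter> space L.lim
          \<longleftrightarrow> \<omega> \<in> prod_emb (tree_verts d) (\<lambda>_. borel) A X"
        by (simp add: prod_emb_def space_PiM conj_commute)
    qed
    also have "measure L.lim (prod_emb (tree_verts d) (\<lambda>_. borel) A X) = measure (fidi d A) X"
      by (rule L.measure_lim_emb[OF A(2,1) X])
    also have "\<dots> = limit_marginal d A p"
    proof -
      \<comment> \<open>Values of q on A are below d, where \<open>clip\<close> undoes
        \<open>real\<close>. If p x \<ge> d for some x in A, both sides are false.\<close>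
      have "real_config A q \<in> X \<longleftrightarrow> (\<forall>x\<in>A. q x = p x)" if "q \<in> stable_configs d A" for q
        using that by (auto simp: real_config_def X_def PiE_iff clip_def stable_configs_def)
      then have "{q \<in> stable_configs d A. real_config A q \<in> X} = {q \<in> stable_configs d A. \<forall>x\<in>A. q x = p x}"
        by blast
      then have "emeasure (fidi d A) X = (\<Sum>q\<in>{q \<in> stable_configs d A. \<forall>x\<in>A. q x = p x}. ennreal (limit_marginal d A q))"
        unfolding emeasure_fidi[OF A(1) X] by simp
      also have "\<dots> = ennreal (limit_marginal d A p)"
        unfolding limit_marginal_sum[OF assms A order.refl, of p]
        using limit_marginal_nonneg[OF assms A] by (intro sum_ennreal) auto
      finally show ?thesis using limit_marginal_nonneg[OF assms A] by (simp add: measure_def)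
    qed
    finally show ?thesis .
  qed
  ultimately show ?thesis by blast
qed

text \<open>Finite-dimensional rectangles determine a probability measure on the product, and over a
  finite alphabet each is a finite disjoint union of cylinders with prescribed values.\<close>

lemma config_measure_eqI:
  assumes "prob_space \<mu>" "prob_space \<nu>"
    and sets: "sets \<mu> = sets (config_space d)" "sets \<nu> = sets (config_space d)"
    and eq: "\<And>A p. finite A \<Longrightarrow> A \<subseteq> tree_verts d \<Longrightarrow>
      measure \<mu> {\<omega> \<in> space \<mu>. \<forall>x\<in>A. \<omega> x = p x} = measure \<nu> {\<omega> \<in> space \<nu>. \<forall>x\<in>A. \<omega> x = p x}"
  shows "\<mu> = \<nu>"
proof (rule measure_eqI_PiM_infinite)
  show "sets \<mu> = sets (PiM (tree_verts d) (\<lambda>_. count_space {..<d}))"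
    "sets \<nu> = sets (PiM (tree_verts d) (\<lambda>_. count_space {..<d}))"
    using sets by (simp_all add: config_space_def)
  show "finite_measure \<mu>" using assms(1) by (rule prob_space.finite_measure)
  fix A J assume J: "finite J" "J \<subseteq> tree_verts d" "\<And>i. i \<in> J \<Longrightarrow> A i \<in> sets (count_space {..<d})"
  let ?c = "\<lambda>p. {\<omega> \<in> space (config_space d). \<forall>x\<in>J. \<omega> x = p x}"
  let ?E = "prod_emb (tree_verts d) (\<lambda>_. count_space {..<d}) J (Pi\<^sub>E J A)"
  have "finite (A i)" if "i \<in> J" for i
    using J(3)[OF that] by (simp add: finite_subset)
  then have fin: "finite (Pi\<^sub>E J A)" using J(1) by (intro finite_PiE) auto
  have E: "?E = (\<Union>p\<in>Pi\<^sub>E J A. ?c p)"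
  proof (intro set_eqI iffI)
    fix \<omega> assume "\<omega> \<in> ?E"
    then have "restrict \<omega> J \<in> Pi\<^sub>E J A" "\<omega> \<in> space (config_space d)"
      by (auto simp: prod_emb_def config_space_def space_PiM)
    moreover have "\<forall>x\<in>J. \<omega> x = restrict \<omega> J x" by simp
    ultimately show "\<omega> \<in> (\<Union>p\<in>Pi\<^sub>E J A. ?c p)" by blast
  next
    fix \<omega> assume "\<omega> \<in> (\<Union>p\<in>Pi\<^sub>E J A. ?c p)"
    then obtain p where p: "p \<in> Pi\<^sub>E J A" "\<omega> \<in> ?c p" by blast
    then have "\<forall>x\<in>J. \<omega> x \<in> A x" by (auto simp: PiE_iff)
    then show "\<omega> \<in> ?E" using p(2) by (simp add: prod_emb_def config_space_def space_PiM PiE_iff)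
  qed
  have disj: "disjoint_family_on ?c (Pi\<^sub>E J A)"
    unfolding disjoint_family_on_def
  proof (intro ballI impI)
    fix p q assume "p \<in> Pi\<^sub>E J A" "q \<in> Pi\<^sub>E J A" "p \<noteq> q"
    then obtain x where "x \<in> J" "p x \<noteq> q x" using PiE_ext by blast
    then show "?c p \<inter> ?c q = {}" by auto
  qed
  have *: "emeasure M ?E = ennreal (\<Sum>p\<in>Pi\<^sub>E J A. measure M (?c p))"
    if M: "prob_space M" "sets M = sets (config_space d)" for M
  proof -
    interpret prob_space M by fact
    have "?c p \<in> sets M" for p using cylinder_measurable[OF J(1,2)] M(2) by simp
    then have "measure M ?E = (\<Sum>p\<in>Pi\<^sub>E J A. measure M (?c p))"
      unfolding E using fin disj by (intro finite_measure_finite_Union) auto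
    then show ?thesis by (simp add: emeasure_eq_measure)
  qed
  have "space \<mu> = space (config_space d)" "space \<nu> = space (config_space d)"
    using sets by (auto dest: sets_eq_imp_space_eq)
  then have "measure \<mu> (?c p) = measure \<nu> (?c p)" for p using eq[OF J(1,2), of p] by simp
  then show "emeasure \<mu> ?E = emeasure \<nu> ?E"
    using *[OF assms(1) sets(1)] *[OF assms(2) sets(2)] by simp
qed

theorem theorem8p1:
  fixes d :: nat
  assumes "d \<ge> 3"
  shows "\<exists>\<nu>. prob_space \<nu> \<and> sets \<nu> = sets (config_space d)
     \<and> (\<forall>V. exhaustion d V \<longrightarrow> sandpile_converges d V \<nu>)
     \<and> (\<forall>V \<nu>'. exhaustion d V \<longrightarrow> prob_space \<nu>' \<longrightarrow> sets \<nu>' = sets (config_space d)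
            \<longrightarrow> sandpile_converges d V \<nu>' \<longrightarrow> \<nu>' = \<nu>)"
proof -
  obtain \<nu> where \<nu>: "prob_space \<nu>" "sets \<nu> = sets (config_space d)"
    "\<And>A p. finite A \<Longrightarrow> A \<subseteq> tree_verts d \<Longrightarrow>
      measure \<nu> {\<omega> \<in> space \<nu>. \<forall>x\<in>A. \<omega> x = p x} = limit_marginal d A p"
    using limit_measure_exists[OF assms] by blast
  have conv: "sandpile_converges d V \<nu>" if "exhaustion d V" for V
    unfolding sandpile_converges_def using \<nu>(3) limit_marginal[OF assms _ _ that] by simp
  \<comment> \<open>A single exhaustion suffices: the cylinder probabilities of both measures are
    limits of the same real sequence.\<close>
  have "\<nu>' = \<nu>" if V: "exhaustion d V" and \<nu>': "prob_space \<nu>'" "sets \<nu>' = sets (config_space d)"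
    "sandpile_converges d V \<nu>'" for V \<nu>'
  proof (rule config_measure_eqI[OF \<nu>'(1) \<nu>(1) \<nu>'(2) \<nu>(2)])
    fix A p assume "finite A" "A \<subseteq> tree_verts d"
    then show "measure \<nu>' {\<omega> \<in> space \<nu>'. \<forall>x\<in>A. \<omega> x = p x} = measure \<nu> {\<omega> \<in> space \<nu>. \<forall>x\<in>A. \<omega> x = p x}"
      using \<nu>'(3) conv[OF V] unfolding sandpile_converges_def by (blast intro: LIMSEQ_unique)
  qed
  then show ?thesis using \<nu>(1,2) conv by blast
qed

end
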